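(* Let $\mathfrak{g}=\mathfrak{g}_L\ltimes\mathfrak{h}$ be a Lie algebra with simple Levi subalgebra $\mathfrak{g}_L$ and $\mathfrak{h}=\mathrm{Rad}(\mathfrak{g})$, such that, as a $\mathfrak{g}_L$-module, $\mathfrak{h}=V_n\oplus V_m\oplus V_p\oplus V_k$ with all four summands simple, and such that whenever two summands $V,W$ (possibly equal) satisfy $[V,W]\neq0$, there is a unique summand $U$ with $[V,W]=U$. If $\mathfrak{g}$ is sympathetic, then there exist two of the summands, say $V_p$ and $V_k$ (after relabelling), such that $[\mathfrak{h},\mathfrak{h}]=V_p\oplus V_k$ and $Z(\mathfrak{h})=V_k$. Moreover, up to isomorphism (relabelling the summands), the multiplicative structure of $\mathfrak{h}$ is given by one of the following six tables, where brackets of pairs of summands not listed are zero: (1) $[V_n,V_n]=V_p$, $[V_n,V_m]=V_p$, $[V_m,V_m]=V_k$, $[V_n,V_p]=V_k$, $[V_m,V_p]=V_k$; (2) $[V_n,V_n]=V_k$, $[V_n,V_m]=V_p$, $[V_m,V_m]=0$, $[V_n,V_p]=V_k$, $[V_m,V_p]=V_k$; (3) $[V_n,V_n]=V_k$, $[V_n,V_m]=V_p$, $[V_m,V_m]=V_k$, $[V_n,V_p]=V_k$, $[V_m,V_p]=V_k$; (4) $[V_n,V_n]=V_p$, $[V_n,V_m]=V_p$, $[V_m,V_m]=V_k$, $[V_n,V_p]=V_k$; (5) $[V_n,V_n]=V_k$, $[V_n,V_m]=V_p$, $[V_m,V_m]=V_k$, $[V_n,V_p]=V_k$; (6) $[V_n,V_n]=V_p$,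 $[V_n,V_m]=V_k$, $[V_m,V_m]=V_k$, $[V_n,V_p]=V_k$.
   Context: All Lie algebras and vector spaces are finite dimensional over $\mathbb{C}$. A Lie algebra $\mathfrak{g}$ is sympathetic if $Z(\mathfrak{g})=0$, $\mathfrak{g}=[\mathfrak{g},\mathfrak{g}]$ and $\mathrm{Der}(\mathfrak{g})=\mathrm{ad}(\mathfrak{g})$. $\mathfrak{g}=\mathfrak{g}_L\ltimes\mathfrak{h}$ is a Levi decomposition, and $\mathfrak{h}$ is a $\mathfrak{g}_L$-module via the Lie bracket. $V_n,V_m,V_p,V_k$ are simple submodules of $\mathfrak{h}$ (subscripts are highest weights; distinct summands may be isomorphic). $[A,B]$ denotes the linear span of all brackets $[a,b]$, $a\in A$, $b\in B$. *)

theory Defs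
  imports Complex_Main
begin

text \<open>Finite-dimensional complex Lie algebras. The Lie algebra is the whole type \<^typ>\<open>'a\<close>; its
  subalgebras, ideals and modules are subsets. Notions that are also needed for a subalgebra, such
  as centre and ideal, take the subalgebra as an argument.\<close>

locale lie_algebra = vector_space scale
  for scale :: "complex \<Rightarrow> 'a::ab_group_add \<Rightarrow> 'a" +
  fixes bracket :: "'a \<Rightarrow> 'a \<Rightarrow> 'a"
  assumes finite_dimensional: "\<exists>B. finite B \<and> span B = UNIV"
    and linear_bracket_left: "Vector_Spaces.linear scale scale (\<lambda>x. bracket x y)"
    and linear_bracket_right: "Vector_Spaces.linear scale scale (\<lambda>y. bracket x y)"
    and bracket_self: "bracket x x = 0"
    and jacobi: "bracket x (bracket y z) + bracket y (bracket z x) + bracket z (bracket x y) = 0"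
begin

definition bracket_span :: "'a set \<Rightarrow> 'a set \<Rightarrow> 'a set" where
  "bracket_span A B = span {bracket a b | a b. a \<in> A \<and> b \<in> B}"

definition centre :: "'a set \<Rightarrow> 'a set" where
  "centre S = {z \<in> S. \<forall>x\<in>S. bracket z x = 0}"

definition subalgebra :: "'a set \<Rightarrow> bool" where
  "subalgebra S \<longleftrightarrow> subspace S \<and> (\<forall>x\<in>S. \<forall>y\<in>S. bracket x y \<in> S)"

definition ideal_of :: "'a set \<Rightarrow> 'a set \<Rightarrow> bool" where
  "ideal_of I S \<longleftrightarrow> subspace I \<and> I \<subseteq> S \<and> (\<forall>x\<in>S. \<forall>y\<in>I. bracket x y \<in> I)"

primrec derived_series :: "'a set \<Rightarrow> nat \<Rightarrow> 'a set" where
  "derived_series S 0 = S"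
| "derived_series S (Suc i) = bracket_span (derived_series S i) (derived_series S i)"

definition solvable :: "'a set \<Rightarrow> bool" where
  "solvable S \<longleftrightarrow> (\<exists>i. derived_series S i = {0})"

definition simple_subalgebra :: "'a set \<Rightarrow> bool" where
  "simple_subalgebra S \<longleftrightarrow> subalgebra S \<and> bracket_span S S \<noteq> {0} \<and>
     (\<forall>I. ideal_of I S \<longrightarrow> I = {0} \<or> I = S)"

definition semisimple_subalgebra :: "'a set \<Rightarrow> bool" where
  "semisimple_subalgebra S \<longleftrightarrow> subalgebra S \<and> (\<forall>I. ideal_of I S \<and> solvable I \<longrightarrow> I = {0})"

text \<open>The radical is the largest solvable ideal.\<close>

definition is_radical :: "'a set \<Rightarrow> bool" where
  "is_radical R \<longleftrightarrow> ideal_of R UNIV \<and> solvable R \<and>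
     (\<forall>I. ideal_of I UNIV \<and> solvable I \<longrightarrow> I \<subseteq> R)"

definition levi_decomposition :: "'a set \<Rightarrow> 'a set \<Rightarrow> bool" where
  "levi_decomposition L R \<longleftrightarrow> semisimple_subalgebra L \<and> is_radical R \<and>
     L \<inter> R = {0} \<and> (\<forall>x. \<exists>a\<in>L. \<exists>b\<in>R. x = a + b)"

definition derivation :: "('a \<Rightarrow> 'a) \<Rightarrow> bool" where
  "derivation D \<longleftrightarrow> Vector_Spaces.linear scale scale D \<and>
     (\<forall>x y. D (bracket x y) = bracket (D x) y + bracket x (D y))"

definition ad :: "'a \<Rightarrow> 'a \<Rightarrow> 'a" where
  "ad x = (\<lambda>y. bracket x y)"

definition sympathetic :: bool where
  "sympathetic \<longleftrightarrow> centre UNIV = {0} \<and> bracket_span UNIV UNIV = UNIV \<and>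
     {D. derivation D} = range ad"

text \<open>The action of \<open>L\<close> is always the bracket.\<close>

definition submodule :: "'a set \<Rightarrow> 'a set \<Rightarrow> bool" where
  "submodule L V \<longleftrightarrow> subspace V \<and> (\<forall>x\<in>L. \<forall>v\<in>V. bracket x v \<in> V)"

definition simple_submodule :: "'a set \<Rightarrow> 'a set \<Rightarrow> bool" where
  "simple_submodule L V \<longleftrightarrow> submodule L V \<and> V \<noteq> {0} \<and>
     (\<forall>W. submodule L W \<and> W \<subseteq> V \<longrightarrow> W = {0} \<or> W = V)"

text \<open>\<open>H\<close> is the internal direct sum of the subspaces \<open>V i\<close>, for \<open>i\<close> in the finite set \<open>I\<close>.\<close>

definition is_direct_sum :: "'i set \<Rightarrow> ('i \<Rightarrow> 'a set) \<Rightarrow> 'a set \<Rightarrow> bool" where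
  "is_direct_sum I V H \<longleftrightarrow> finite I \<and> (\<forall>i\<in>I. subspace (V i)) \<and>
     H = {\<Sum>i\<in>I. v i | v. \<forall>i\<in>I. v i \<in> V i} \<and>
     (\<forall>v. (\<forall>i\<in>I. v i \<in> V i) \<and> (\<Sum>i\<in>I. v i) = 0 \<longrightarrow> (\<forall>i\<in>I. v i = 0))"

text \<open>A multiplication table is a set of triples \<open>(i, j, c)\<close>, each standing for
  \<open>[V i, V j] = V c\<close>. A pair is listed in one order only, and brackets of unlisted pairs
  vanish.\<close>

definition has_table :: "('i \<Rightarrow> 'a set) \<Rightarrow> ('i \<times> 'i \<times> 'i) set \<Rightarrow> bool" where
  "has_table V T \<longleftrightarrow>
     (\<forall>(i, j, c)\<in>T. bracket_span (V i) (V j) = V c) \<and>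
     (\<forall>i j. (\<forall>c. (i, j, c) \<notin> T \<and> (j, i, c) \<notin> T) \<longrightarrow> bracket_span (V i) (V j) = {0})"

end

text \<open>The subscripts of the four summands. They are pure labels: summands with different labels
  may be isomorphic as modules, so a subscript is not identified with a highest weight.\<close>

datatype label = n | m | p | k

lemma UNIV_label: "UNIV = {n, m, p, k}"
  by (auto intro: label.exhaust)

end

theory Submission imports Defs "HOL-Computational_Algebra.Polynomial"
begin

text \<open>The radical of a perfect Lie algebra is nilpotent. Here this comes from Jacobson's lemma (if
  \<open>x = [a, y]\<close> commutes with \<open>y\<close>, then \<open>x\<close> is nilpotent), applied to subquotients of \<open>\<hh>\<close> on which
  sums of summands act as commuting operators. Hence the four labels can be ordered so that a product
  exceeds both factors, which leaves 288 tables. The Jacobi identity restricts them further, and every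
  solution of the weight equations \<open>w i + w j = w c\<close>, for \<open>[V i, V j] = V c\<close>, gives a diagonal
  derivation; this derivation is inner and vanishes on \<open>L\<close>, and as \<open>\<hh>\<close> is nilpotent it is zero. So
  the weight equations have rank four, and the six tables are all that remains. The centre of \<open>\<hh>\<close> may
  a priori sit diagonally in isomorphic summands, so it is computed componentwise from the table.\<close>

section \<open>Nilpotent operators\<close>

text \<open>The hypothesis on brackets turns the radical into a partial commutative operation on
  labels, and most of the argument runs on sets of labels. Arbitrary submodules would not do:
  isomorphic summands produce submodules that are not sums of some of the \<open>V i\<close>. The
  obstacle to nilpotency is a summand on which \<open>L\<close> acts trivially. If
  \<open>[L, V i] = V i\<close>, Jacobson's lemma applies to \<open>[a, y]\<close> with
  \<open>a\<close> in \<open>L\<close> and \<open>y\<close> in \<open>V i\<close>, because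
  \<open>[[a, y], y]\<close> falls into \<open>[V i, V i]\<close>. A trivial summand is reached only
  through perfectness, as a product \<open>[V d, V c]\<close>, and then \<open>[[a, y], y]\<close>
  falls into \<open>[V i, V c]\<close>, where \<open>c\<close> may lie outside the ideal
  \<open>A\<close> under consideration. Hence nilpotency passes from \<open>[A, A]\<close> to
  \<open>A\<close> in two steps, through \<open>[A, g]\<close> for the whole algebra
  \<open>g\<close>.\<close>

context lie_algebra
begin

abbreviation lin :: "('a \<Rightarrow> 'a) \<Rightarrow> bool" where
  "lin \<equiv> Vector_Spaces.linear scale scale"

sublocale endo: vector_space_pair scale scale ..

lemmas lin_simps = endo.linear_add endo.linear_diff endo.linear_neg endo.linear_0 endo.linear_scale
  endo.linear_sum

lemma lin_compose: "lin f \<Longrightarrow> lin g \<Longrightarrow> lin (\<lambda>v. f (g v))"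
  by (rule Vector_Spaces.linear_compose[unfolded o_def])

lemma lin_funpow: "lin f \<Longrightarrow> lin (f ^^ r)"
proof (induction r)
  case 0
  then show ?case using linear_id by (simp add: id_def)
next
  case (Suc r)
  then show ?case using lin_compose[of f "f ^^ r"] by (simp add: o_def)
qed

lemma funpow_commute:
  assumes "\<And>v. f (g v) = g (f v)"
  shows "(f ^^ r) (g v) = g ((f ^^ r) v)"
  by (induction r) (auto simp: assms)

lemma lin_eq_0_span:
  assumes "lin f" "\<And>v. v \<in> S \<Longrightarrow> f v = 0" "v \<in> span S"
  shows "f v = 0"
  using endo.linear_eq_0_on_span[OF assms(1) assms(2) assms(3)] by simp

lemma lin_image_span:
  assumes "lin f" "v \<in> span S"
  shows "f v \<in> span (f ` S)"
  using endo.linear_span_image[OF assms(1)] assms(2) by blast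

section \<open>Evaluation of polynomials at an endomorphism, in Horner form\<close>

definition poly_map :: "('a \<Rightarrow> 'a) \<Rightarrow> complex poly \<Rightarrow> 'a \<Rightarrow> 'a" where
  "poly_map f q = fold_coeffs (\<lambda>c g v. scale c v + f (g v)) q (\<lambda>_. 0)"

context
  fixes f :: "'a \<Rightarrow> 'a"
  assumes f: "lin f"
begin

lemma poly_map_0 [simp]: "poly_map f 0 v = 0"
  by (simp add: poly_map_def)

lemma poly_map_pCons [simp]: "poly_map f (pCons c q) v = scale c v + f (poly_map f q v)"
  by (cases "c = 0 \<and> q = 0") (auto simp: poly_map_def lin_simps[OF f])

lemma poly_map_lin: "lin (poly_map f q)"
proof (induction q)
  case 0
  have "poly_map f 0 = (\<lambda>_. 0)" by auto
  then show ?case using endo.linear_zero by simp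
next
  case (pCons c q)
  have "poly_map f (pCons c q) = (\<lambda>v. scale c v + f (poly_map f q v))" by auto
  then show ?case
    using endo.linear_compose_add[OF linear_scale_self lin_compose[OF f pCons(2)]] by simp
qed

lemma poly_map_add: "poly_map f (q + r) v = poly_map f q v + poly_map f r v"
proof (induction q arbitrary: r)
  case 0
  then show ?case by simp
next
  case (pCons c q)
  show ?case
    by (cases r) (simp add: pCons.IH lin_simps[OF f] scale_left_distrib)
qed

lemma poly_map_smult: "poly_map f (smult c q) v = scale c (poly_map f q v)"
  by (induction q) (auto simp: lin_simps[OF f] scale_right_distrib)

lemma poly_map_mult: "poly_map f (q * r) v = poly_map f q (poly_map f r v)"
  by (induction q) (auto simp: poly_map_add poly_map_smult)

lemma poly_map_diff: "poly_map f (q - r) v = poly_map f q v - poly_map f r v"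
  using poly_map_add[of "q - r" r v] by (simp add: algebra_simps)

lemma poly_map_monom: "poly_map f (monom 1 r) v = (f ^^ r) v"
  by (induction r) (auto simp: monom_Suc monom_0 one_pCons lin_simps[OF f])

lemma poly_map_commute:
  assumes g: "lin g" and "\<And>v. g (f v) = f (g v)"
  shows "g (poly_map f q v) = poly_map f q (g v)"
  by (induction q) (auto simp: lin_simps[OF g] assms(2))

lemma exists_annihilator_at: "\<exists>q. q \<noteq> 0 \<and> poly_map f q v = 0"
proof -
  have "\<exists>r. (f ^^ r) v \<in> span ((\<lambda>i. (f ^^ i) v) ` {..<r})"
  proof (rule ccontr)
    assume no: "\<nexists>r. (f ^^ r) v \<in> span ((\<lambda>i. (f ^^ i) v) ` {..<r})"
    \<comment> \<open>If no iterate depended on the earlier ones, the iterates of \<open>v\<close>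
      would form independent sets of every size.\<close>
    have *: "independent ((\<lambda>i. (f ^^ i) v) ` {..<r}) \<and> card ((\<lambda>i. (f ^^ i) v) ` {..<r}) = r" for r
    proof (induction r)
      case 0
      then show ?case using independent_empty by simp
    next
      case (Suc r)
      let ?S = "(\<lambda>i. (f ^^ i) v) ` {..<r}"
      have "(f ^^ r) v \<notin> span ?S"
        by (rule contrapos_nn[OF no]) (rule exI)
      moreover from this have "(f ^^ r) v \<notin> ?S" by (rule contrapos_nn) (rule span_base)
      moreover have "(\<lambda>i. (f ^^ i) v) ` {..<Suc r} = insert ((f ^^ r) v) ?S"
        by (simp add: lessThan_Suc)
      ultimately show ?case using Suc independent_insertI[of "(f ^^ r) v" ?S]
        by (simp del: image_insert)
    qed
    obtain B where B: "finite B" "span B = UNIV" using finite_dimensional by blast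
    show False
      using independent_span_bound[OF B(1), of "(\<lambda>i. (f ^^ i) v) ` {..<Suc (card B)}"] *[of "Suc (card B)"] B(2)
      by simp
  qed
  then obtain r where r: "(f ^^ r) v \<in> span ((\<lambda>i. (f ^^ i) v) ` {..<r})" by (rule exE)
  \<comment> \<open>The bound on the coefficients of \<open>q\<close> keeps the leading term of
    \<open>monom 1 r - q\<close> from cancelling, so that this annihilator is not zero.\<close>
  have "\<exists>q. u = poly_map f q v \<and> (\<forall>i\<ge>r. coeff q i = 0)"
    if "u \<in> span ((\<lambda>i. (f ^^ i) v) ` {..<r})" for u
    using that
  proof (induction rule: span_induct_alt)
    case base
    show ?case by (rule exI[of _ 0]) simp
  next
    case (step c x y)
    then obtain i where i: "i < r" "x = (f ^^ i) v" by blast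
    from step obtain q where q: "y = poly_map f q v" "\<forall>i\<ge>r. coeff q i = 0" by blast
    show ?case
      by (rule exI[of _ "smult c (monom 1 i) + q"])
        (use i q in \<open>auto simp: poly_map_add poly_map_smult poly_map_monom\<close>)
  qed
  from this[OF r] obtain q where q: "(f ^^ r) v = poly_map f q v" "\<forall>i\<ge>r. coeff q i = 0" by blast
  have "coeff (monom 1 r - q) r = 1" using q(2) by simp
  then have "monom 1 r - q \<noteq> 0" by (metis coeff_0 zero_neq_one)
  moreover have "poly_map f (monom 1 r - q) v = 0"
    by (simp add: poly_map_diff poly_map_monom q(1))
  ultimately show ?thesis by blast
qed

text \<open>Polynomials in \<open>f\<close> commute, so the product of annihilators of the members
  of a finite spanning set kills every one of them.\<close>

lemma exists_annihilator: "\<exists>q. q \<noteq> 0 \<and> (\<forall>v. poly_map f q v = 0)"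
proof -
  obtain B where B: "finite B" "span B = UNIV" using finite_dimensional by blast
  obtain Q where Q: "\<And>v. Q v \<noteq> 0" "\<And>v. poly_map f (Q v) v = 0"
    using exists_annihilator_at by metis
  have "poly_map f (\<Prod>e\<in>B. Q e) v = 0" for v
  proof (rule lin_eq_0_span[OF poly_map_lin, of B])
    fix e assume "e \<in> B"
    then have "(\<Prod>e\<in>B. Q e) = (\<Prod>e\<in>B - {e}. Q e) * Q e" using B(1) by (simp add: prod.remove[of B e] mult.commute)
    then show "poly_map f (\<Prod>e\<in>B. Q e) e = 0"
      using poly_map_mult[of "\<Prod>e\<in>B - {e}. Q e" "Q e" e] Q(2)[of e] endo.linear_0[OF poly_map_lin] by simp
  qed (use B in auto)
  moreover have "(\<Prod>e\<in>B. Q e) \<noteq> 0" using Q(1) B(1) by simp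
  ultimately show ?thesis by blast
qed

end

text \<open>Jacobson's lemma: taking the commutator of \<open>q(f) = 0\<close> with \<open>g\<close> replaces \<open>q\<close> by its derivative,
  at the cost of a power of \<open>h\<close>; after \<open>degree q\<close> steps only a power of \<open>h\<close> is left.\<close>

lemma nilpotent_commutator:
  assumes g: "lin g" and f: "lin f" and h: "\<And>v. h v = g (f v) - f (g v)"
    and hf: "\<And>v. h (f v) = f (h v)"
  shows "\<exists>d. \<forall>v. (h ^^ d) v = 0"
proof -
  have "h = (\<lambda>v. g (f v) - f (g v))" using h by auto
  then have hl: "lin h"
    using endo.linear_compose_sub[OF lin_compose[OF g f] lin_compose[OF f g]] by simp
  have comm: "(h ^^ r) (poly_map f q v) = poly_map f q ((h ^^ r) v)" for r q v
    by (rule poly_map_commute[OF f lin_funpow[OF hl]]) (rule funpow_commute, rule hf)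
  have h1: "h (poly_map f q v) = poly_map f q (h v)" for q v using comm[of 1 q v] by simp
  have der: "g (poly_map f q v) = poly_map f q (g v) + poly_map f (pderiv q) (h v)" for q v
  proof (induction q)
    case 0
    then show ?case by (simp add: f lin_simps[OF g])
  next
    case (pCons c q)
    have "g (f (poly_map f q v)) = f (g (poly_map f q v)) + h (poly_map f q v)" by (simp add: h)
    then show ?case
      by (simp add: f lin_simps[OF g] lin_simps[OF f] pCons.IH h1 pderiv_pCons poly_map_add)
  qed
  have "\<exists>d. \<forall>v. (h ^^ d) v = 0" if "q \<noteq> 0" "\<And>v. poly_map f q ((h ^^ r) v) = 0" for q r
    using that
  proof (induction "degree q" arbitrary: q r rule: less_induct)
    case less
    show ?case
    proof (cases "degree q = 0")
      case True
      then obtain c where "q = [:c:]" by (metis degree_eq_zeroE)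
      with less.prems have "\<forall>v. (h ^^ r) v = 0" by (auto simp: f lin_simps[OF f])
      then show ?thesis by blast
    next
      case False
      \<comment> \<open>Since \<open>g\<close> need not commute with \<open>h\<close>, the term
        \<open>q(f) g h^r\<close> does not vanish by itself. A further factor \<open>h^r\<close> on
        the left, which commutes with \<open>q(f)\<close>, kills it; this explains the exponent
        \<open>r + Suc r\<close>.\<close>
      have "poly_map f (pderiv q) ((h ^^ (r + Suc r)) v) = 0" for v
      proof -
        have "poly_map f q (g ((h ^^ r) v)) + poly_map f (pderiv q) (h ((h ^^ r) v)) = 0"
          using der[of q "(h ^^ r) v"] less.prems(2)[of v] by (simp add: lin_simps[OF g])
        then have "(h ^^ r) (poly_map f q (g ((h ^^ r) v)) + poly_map f (pderiv q) (h ((h ^^ r) v))) = 0"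
          by (simp add: lin_simps[OF lin_funpow[OF hl]])
        then show ?thesis
          by (simp add: lin_simps[OF lin_funpow[OF hl]] comm less.prems(2) funpow_add funpow_swap1)
      qed
      moreover have "degree (pderiv q) < degree q" using False by (simp add: degree_pderiv)
      moreover have "pderiv q \<noteq> 0" using False by (simp add: pderiv_eq_0_iff)
      ultimately show ?thesis using less.hyps by blast
    qed
  qed
  moreover obtain q where "q \<noteq> 0" "\<forall>v. poly_map f q v = 0" using exists_annihilator[OF f] by blast
  ultimately show ?thesis by blast
qed

text \<open>This takes the place of a simultaneous triangular form. With \<open>d\<close> least such
  that \<open>x^d\<close> kills \<open>U\<close>, the set \<open>x^(d-1) U\<close> inherits the last
  hypothesis without the operator \<open>x\<close>, because \<open>x\<close> kills it and the others
  commute with \<open>x\<close>. By induction it is zero, against the choice of \<open>d\<close>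
  unless \<open>d = 0\<close>.\<close>

lemma commuting_nilpotent_family:
  assumes "finite X" "\<And>x. x \<in> X \<Longrightarrow> lin x" "\<And>x. x \<in> X \<Longrightarrow> \<exists>d. \<forall>v. (x ^^ d) v = 0"
    and "\<And>x y v. x \<in> X \<Longrightarrow> y \<in> X \<Longrightarrow> x (y v) = y (x v)"
    and "U \<subseteq> span (\<Union>x\<in>X. x ` U)"
  shows "U \<subseteq> {0}"
  using assms
proof (induction X arbitrary: U rule: finite_induct)
  case empty
  then show ?case by simp
next
  case (insert x X)
  define d where "d = (LEAST d. (x ^^ d) ` U \<subseteq> {0})"
  have "\<exists>d. (x ^^ d) ` U \<subseteq> {0}" using insert.prems(2)[of x] by auto
  then have d: "(x ^^ d) ` U \<subseteq> {0}" unfolding d_def by (rule LeastI_ex)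
  show ?case
  proof (cases d)
    case 0
    then show ?thesis using d by simp
  next
    case (Suc e)
    let ?U = "(x ^^ e) ` U"
    have e: "\<not> ?U \<subseteq> {0}" using not_less_Least[of e] Suc unfolding d_def by (metis lessI)
    have xl: "lin (x ^^ e)" using insert.prems(1) lin_funpow by blast
    have "?U \<subseteq> span (\<Union>y\<in>X. y ` ?U)"
    proof
      fix u assume "u \<in> ?U"
      then obtain w where w: "w \<in> U" "u = (x ^^ e) w" by blast
      have "w \<in> span (\<Union>y\<in>insert x X. y ` U)" using w insert.prems(4) by blast
      then have "u \<in> span ((x ^^ e) ` (\<Union>y\<in>insert x X. y ` U))"
        unfolding w(2) by (rule lin_image_span[OF xl])
      also have "\<dots> \<subseteq> span (\<Union>y\<in>X. y ` ?U)"
      proof (rule span_minimal[OF _ subspace_span], rule subsetI)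
        fix s assume "s \<in> (x ^^ e) ` (\<Union>y\<in>insert x X. y ` U)"
        then obtain y t where y: "y \<in> insert x X" "t \<in> U" "s = (x ^^ e) (y t)" by blast
        show "s \<in> span (\<Union>y\<in>X. y ` ?U)"
        proof (cases "y = x")
          case True
          then have "s = (x ^^ d) t" using y Suc by (metis funpow_Suc_right o_apply)
          then have "s = 0" using d y(2) by blast
          then show ?thesis by (simp add: span_zero)
        next
          case False
          then have "y \<in> X" using y by simp
          have "s = y ((x ^^ e) t)"
            unfolding y(3) by (rule funpow_commute) (use insert.prems(3) y in blast)
          then show ?thesis using \<open>y \<in> X\<close> y(2) by (auto intro!: span_base)
        qed
      qed
      finally show "u \<in> span (\<Union>y\<in>X. y ` ?U)" .
    qed
    then have "?U \<subseteq> {0}" by (intro insert.IH) (use insert.prems in auto)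
    then show ?thesis using e by blast
  qed
qed

end

section \<open>Homogeneous components\<close>

context lie_algebra
begin

lemma linI:
  "(\<And>x y. f (x + y) = f x + f y) \<Longrightarrow> (\<And>c x. f (scale c x) = scale c (f x)) \<Longrightarrow> lin f"
  by (simp add: Vector_Spaces.linear_iff vector_space_axioms)

lemmas bracket_simps = lin_simps[OF linear_bracket_left] lin_simps[OF linear_bracket_right]

lemma bracket_antisym: "bracket x y = - bracket y x"
proof -
  have "bracket x (x + y) + bracket y (x + y) = 0"
    using endo.linear_add[OF linear_bracket_left, of x y "x + y"] bracket_self[of "x + y"] by simp
  then have "bracket x y + bracket y x = 0" by (simp add: bracket_simps bracket_self)
  then show ?thesis by (rule eq_neg_iff_add_eq_0[THEN iffD2])
qed

lemma bracket_bracket_left: "bracket (bracket x y) z = bracket x (bracket y z) - bracket y (bracket x z)"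
proof -
  have "bracket x (bracket y z) + bracket y (bracket z x) + bracket z (bracket x y) = 0" by (rule jacobi)
  moreover have "bracket y (bracket z x) = - bracket y (bracket x z)"
    using bracket_antisym[of z x] by (simp add: bracket_simps)
  moreover have "bracket z (bracket x y) = - bracket (bracket x y) z" by (rule bracket_antisym)
  ultimately show ?thesis by (simp add: algebra_simps)
qed

lemma bracket_jacobi_cyclic:
  "bracket (bracket x y) z = - bracket (bracket y z) x - bracket (bracket z x) y"
proof -
  have "- bracket (bracket y z) x + - bracket (bracket z x) y + - bracket (bracket x y) z = 0"
    using jacobi[of x y z] bracket_antisym[of x "bracket y z"] bracket_antisym[of y "bracket z x"]
      bracket_antisym[of z "bracket x y"] by simp
  then have "- bracket (bracket y z) x + - bracket (bracket z x) y = - (- bracket (bracket x y) z)"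
    by (rule eq_neg_iff_add_eq_0[THEN iffD2])
  then show ?thesis by simp
qed

lemma bracket_span_subset:
  assumes "subspace U" "\<And>x y. x \<in> A \<Longrightarrow> y \<in> B \<Longrightarrow> bracket x y \<in> U"
  shows "bracket_span A B \<subseteq> U"
  unfolding bracket_span_def by (rule span_minimal) (use assms in auto)

lemma bracket_in_bracket_span: "x \<in> A \<Longrightarrow> y \<in> B \<Longrightarrow> bracket x y \<in> bracket_span A B"
  unfolding bracket_span_def by (rule span_base) blast

lemma bracket_span_commute: "bracket_span A B = bracket_span B A"
proof -
  have "bracket_span A B \<subseteq> bracket_span B A" for A B
  proof (rule bracket_span_subset)
    show "subspace (bracket_span B A)" unfolding bracket_span_def by (rule subspace_span)
    fix x y assume "x \<in> A" "y \<in> B"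
    then show "bracket x y \<in> bracket_span B A"
      using bracket_in_bracket_span[of y B x A] bracket_antisym[of x y]
      by (simp add: bracket_span_def span_neg)
  qed
  then show ?thesis by blast
qed

lemma bracket_span_nonzero:
  assumes "bracket_span A B \<noteq> {0}"
  obtains x y where "x \<in> A" "y \<in> B" "bracket x y \<noteq> 0"
proof -
  have "0 \<in> bracket_span A B" by (simp add: bracket_span_def span_zero)
  then have "\<not> bracket_span A B \<subseteq> {0}" using assms by blast
  then have "\<exists>x\<in>A. \<exists>y\<in>B. bracket x y \<noteq> 0"
    using bracket_span_subset[of "{0}" A B] by (auto simp: subspace_def)
  then show ?thesis using that by blast
qed

lemma finite_independent: "independent S \<Longrightarrow> finite S"
proof -
  assume S: "independent S"
  obtain B where "finite B" "span B = UNIV" using finite_dimensional by blast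
  then show "finite S" using independent_span_bound[of B S] S by auto
qed

end

text \<open>The number of summands is left open: nilpotency, rigidity of weights and the criterion
  for the centre hold for any finite index type, and four labels enter only with the
  classification.\<close>

locale sympathetic_sum = lie_algebra scale bracket
  for scale :: "complex \<Rightarrow> 'a::ab_group_add \<Rightarrow> 'a" and bracket +
  fixes L H :: "'a set" and V :: "'i::finite \<Rightarrow> 'a set"
  assumes levi: "levi_decomposition L H"
    and simple_L: "simple_subalgebra L"
    and simple_V: "simple_submodule L (V i)"
    and sum_V: "is_direct_sum UNIV V H"
    and product_V: "bracket_span (V i) (V j) \<noteq> {0} \<Longrightarrow> \<exists>!c. bracket_span (V i) (V j) = V c"
    and symp: "sympathetic"
begin

lemma subspace_V: "subspace (V i)"
  using simple_V unfolding simple_submodule_def submodule_def by blast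

lemma subspace_L: "subspace L"
  using simple_L unfolding simple_subalgebra_def subalgebra_def by blast

lemma bracket_L_V: "x \<in> L \<Longrightarrow> v \<in> V i \<Longrightarrow> bracket x v \<in> V i"
  using simple_V unfolding simple_submodule_def submodule_def by blast

lemma bracket_L_L: "x \<in> L \<Longrightarrow> y \<in> L \<Longrightarrow> bracket x y \<in> L"
  using simple_L unfolding simple_subalgebra_def subalgebra_def by blast

lemma V_nonzero: obtains v where "v \<in> V i" "v \<noteq> 0"
  using simple_V[of i] subspace_0[OF subspace_V[of i]] unfolding simple_submodule_def by blast

lemma submodule_V_cases: "submodule L W \<Longrightarrow> W \<subseteq> V i \<Longrightarrow> W = {0} \<or> W = V i"
  using simple_V unfolding simple_submodule_def by blast

lemma H_eq: "H = {\<Sum>i\<in>UNIV. v i | v. \<forall>i. v i \<in> V i}"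
  using sum_V unfolding is_direct_sum_def by simp

lemma sum_V_eq_0: "(\<And>i. v i \<in> V i) \<Longrightarrow> (\<Sum>i\<in>UNIV. v i) = 0 \<Longrightarrow> v i = 0"
  using sum_V unfolding is_direct_sum_def by auto

text \<open>The projection onto \<open>V i\<close> along \<open>L\<close> and the other summands.
  The whole family is chosen at once; the part in \<open>L\<close> has no name and is the
  remainder.\<close>

definition component :: "'i \<Rightarrow> 'a \<Rightarrow> 'a" where
  "component i x = (SOME v. (\<forall>i. v i \<in> V i) \<and> x - (\<Sum>i\<in>UNIV. v i) \<in> L) i"

text \<open>Two such families differ by a family whose sum lies both in \<open>L\<close> and in
  \<open>H\<close>, hence is zero, and the sum of the \<open>V i\<close> is direct.\<close>

lemma component_eqI:
  assumes "\<And>i. v i \<in> V i" "x - (\<Sum>i\<in>UNIV. v i) \<in> L"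
  shows "component i x = v i"
proof -
  define w where "w = (SOME v. (\<forall>i. v i \<in> V i) \<and> x - (\<Sum>i\<in>UNIV. v i) \<in> L)"
  have w: "(\<forall>i. w i \<in> V i) \<and> x - (\<Sum>i\<in>UNIV. w i) \<in> L"
    unfolding w_def by (rule someI[of _ v]) (use assms in auto)
  have d: "v i - w i \<in> V i" for i
    using w assms subspace_diff[OF subspace_V] by blast
  have "(x - (\<Sum>i\<in>UNIV. w i)) - (x - (\<Sum>i\<in>UNIV. v i)) \<in> L"
    using w assms subspace_diff[OF subspace_L] by blast
  then have "(\<Sum>i\<in>UNIV. v i - w i) \<in> L" by (simp add: sum_subtractf algebra_simps)
  moreover have "(\<Sum>i\<in>UNIV. v i - w i) \<in> H" unfolding H_eq using d by blast
  ultimately have "(\<Sum>i\<in>UNIV. v i - w i) = 0"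
    using levi unfolding levi_decomposition_def by blast
  then have "v i - w i = 0" using sum_V_eq_0[of "\<lambda>i. v i - w i"] d by blast
  then show ?thesis by (simp add: component_def w_def)
qed

lemma component_in [intro, simp]: "component i x \<in> V i"
  and component_rest: "x - (\<Sum>i\<in>UNIV. component i x) \<in> L"
proof -
  obtain a b where ab: "a \<in> L" "b \<in> H" "x = a + b"
    using levi unfolding levi_decomposition_def by metis
  then obtain v where v: "\<And>i. v i \<in> V i" "b = (\<Sum>i\<in>UNIV. v i)" unfolding H_eq by blast
  then have x: "x - (\<Sum>i\<in>UNIV. v i) \<in> L" using ab by simp
  have "component i x = v i" for i by (rule component_eqI[OF v(1) x])
  then show "component i x \<in> V i" "x - (\<Sum>i\<in>UNIV. component i x) \<in> L" using v x by auto
qed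

lemma component_V: "v \<in> V j \<Longrightarrow> component i v = (if i = j then v else 0)"
  by (rule component_eqI) (auto simp: subspace_0[OF subspace_V] subspace_0[OF subspace_L])

lemma component_L: "x \<in> L \<Longrightarrow> component i x = 0"
  by (rule component_eqI) (auto simp: subspace_0[OF subspace_V])

lemma component_H: "x \<in> H \<Longrightarrow> (\<Sum>i\<in>UNIV. component i x) = x"
proof -
  assume "x \<in> H"
  then obtain v where v: "\<And>i. v i \<in> V i" "x = (\<Sum>i\<in>UNIV. v i)" unfolding H_eq by blast
  have "component i x = v i" for i
    by (rule component_eqI) (use v subspace_0[OF subspace_L] in auto)
  then show ?thesis using v by simp
qed

lemma V_subset_H: "V j \<subseteq> H"
proof
  fix v assume "v \<in> V j"
  then have "v = (\<Sum>j\<in>UNIV. component j v)" by (simp add: component_V)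
  then show "v \<in> H" unfolding H_eq by (auto intro!: exI[of _ "\<lambda>j. component j v"])
qed

lemma component_lin: "lin (component i)"
proof (rule linI)
  fix x y
  show "component i (x + y) = component i x + component i y"
  proof (rule component_eqI)
    show "component i x + component i y \<in> V i" for i by (simp add: subspace_add[OF subspace_V])
    show "x + y - (\<Sum>i\<in>UNIV. component i x + component i y) \<in> L"
      using subspace_add[OF subspace_L component_rest[of x] component_rest[of y]]
      by (simp add: sum.distrib algebra_simps)
  qed
next
  fix c x
  show "component i (scale c x) = scale c (component i x)"
  proof (rule component_eqI)
    show "scale c (component i x) \<in> V i" for i by (simp add: subspace_scale[OF subspace_V])
    show "scale c x - (\<Sum>i\<in>UNIV. scale c (component i x)) \<in> L"
      using subspace_scale[OF subspace_L component_rest[of x], of c]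
      by (simp add: scale_sum_right scale_right_diff_distrib)
  qed
qed

lemmas component_simps = lin_simps[OF component_lin]

text \<open>A spanning set on which brackets are controlled by labels; bilinear identities are
  checked here and then extended.\<close>

definition homogeneous :: "'a set" where
  "homogeneous = L \<union> (\<Union>i. V i)"

lemma homogeneous_L: "x \<in> L \<Longrightarrow> x \<in> homogeneous"
  and homogeneous_V: "x \<in> V i \<Longrightarrow> x \<in> homogeneous"
  unfolding homogeneous_def by auto

lemma span_homogeneous: "x \<in> span homogeneous"
proof -
  have "x = (x - (\<Sum>i\<in>UNIV. component i x)) + (\<Sum>i\<in>UNIV. component i x)" by simp
  also have "\<dots> \<in> span homogeneous"
    by (rule span_add[OF span_base[OF homogeneous_L[OF component_rest]]])
      (rule span_sum, rule span_base, rule homogeneous_V, rule component_in)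
  finally show ?thesis .
qed

text \<open>The product on labels, with \<open>None\<close> for a vanishing bracket. Uniqueness in
  \<open>product_V\<close> makes the \<open>THE\<close> well defined.\<close>

definition mult :: "'i \<Rightarrow> 'i \<Rightarrow> 'i option" where
  "mult i j = (if bracket_span (V i) (V j) = {0} then None
     else Some (THE c. bracket_span (V i) (V j) = V c))"

lemma mult_None: "mult i j = None \<longleftrightarrow> bracket_span (V i) (V j) = {0}"
  by (simp add: mult_def)

lemma mult_Some: "mult i j = Some c \<Longrightarrow> bracket_span (V i) (V j) = V c"
proof -
  assume *: "mult i j = Some c"
  then have "bracket_span (V i) (V j) \<noteq> {0}" using mult_None[of i j] by auto
  from theI'[OF product_V[OF this]] * show "bracket_span (V i) (V j) = V c"
    by (auto simp: mult_def split: if_splits)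
qed

lemma mult_commute: "mult i j = mult j i"
  by (simp add: mult_def bracket_span_commute[of "V i"])

lemma bracket_None: "mult i j = None \<Longrightarrow> x \<in> V i \<Longrightarrow> y \<in> V j \<Longrightarrow> bracket x y = 0"
  using bracket_in_bracket_span[of x "V i" y "V j"] by (simp add: mult_None)

lemma bracket_Some: "mult i j = Some c \<Longrightarrow> x \<in> V i \<Longrightarrow> y \<in> V j \<Longrightarrow> bracket x y \<in> V c"
  using bracket_in_bracket_span[of x "V i" y "V j"] by (simp add: mult_Some)

lemma component_bracket_ne:
  "mult i j \<noteq> Some c \<Longrightarrow> x \<in> V i \<Longrightarrow> y \<in> V j \<Longrightarrow> component c (bracket x y) = 0"
  by (cases "mult i j")
    (auto simp: bracket_None component_simps component_V[OF bracket_Some])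

lemma mult_Some_nonzero:
  assumes "mult i j = Some c"
  obtains x y where "x \<in> V i" "y \<in> V j" "bracket x y \<noteq> 0"
  using assms bracket_span_nonzero[of "V i" "V j"] mult_None[of i j] by auto

text \<open>The trace that the Jacobi identity leaves on labels: a single term cannot be the only
  one to reach \<open>V c\<close>. Otherwise the \<open>V c\<close> component of the identity gives
  \<open>[[x, y], z] = 0\<close> throughout, while the elements \<open>[x, y]\<close> span
  \<open>V e\<close> and \<open>[V e, V l]\<close> is not zero.\<close>

lemma mult_jacobi:
  assumes "mult i j = Some e" "mult e l = Some c"
  shows "(\<exists>f. mult j l = Some f \<and> mult f i = Some c) \<or> (\<exists>f. mult l i = Some f \<and> mult f j = Some c)"
proof (rule ccontr)
  assume no: "\<not> ?thesis"
  have zero: "component c (bracket (bracket x y) z) = 0"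
    if "x \<in> V i'" "y \<in> V j'" "z \<in> V l'" "\<nexists>f. mult i' j' = Some f \<and> mult f l' = Some c" for x y z i' j' l'
  proof (cases "mult i' j'")
    case None
    then show ?thesis using that by (simp add: bracket_None bracket_simps component_simps)
  next
    case (Some f)
    then show ?thesis using that bracket_Some[OF Some that(1,2)]
      by (intro component_bracket_ne) auto
  qed
  have three: "bracket (bracket x y) z = 0" if "x \<in> V i" "y \<in> V j" "z \<in> V l" for x y z
  proof -
    have "bracket (bracket x y) z \<in> V c"
      using that assms by (blast intro: bracket_Some)
    then have "bracket (bracket x y) z = component c (bracket (bracket x y) z)"
      by (simp add: component_V)
    also have "\<dots> = - component c (bracket (bracket y z) x) - component c (bracket (bracket z x) y)"
      by (subst bracket_jacobi_cyclic) (simp add: component_simps)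
    also have "\<dots> = 0" using no that by (simp add: zero)
    finally show ?thesis .
  qed
  obtain u z where u: "u \<in> V e" "z \<in> V l" "bracket u z \<noteq> 0"
    using mult_Some_nonzero[OF assms(2)] by blast
  have "u \<in> span {bracket x y | x y. x \<in> V i \<and> y \<in> V j}"
    using u mult_Some[OF assms(1)] by (simp add: bracket_span_def)
  then have "bracket u z = 0"
    by (rule lin_eq_0_span[OF linear_bracket_left, rotated]) (use three u in auto)
  then show False using u by blast
qed

text \<open>This writes every summand as a span of brackets, as Jacobson's lemma requires. By
  simplicity \<open>[L, V i]\<close> is \<open>V i\<close> or zero. In the latter case only products
  of two summands can contribute to the \<open>V i\<close> component of a bracket, and perfectness
  makes one of them do so.\<close>

lemma V_generated:
  "V i = bracket_span L (V i) \<or> bracket_span L (V i) = {0} \<and> (\<exists>a b. mult a b = Some i)"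
proof -
  let ?B = "bracket_span L (V i)"
  have sub: "?B \<subseteq> V i"
    by (rule bracket_span_subset[OF subspace_V]) (rule bracket_L_V)
  have "submodule L ?B"
    unfolding submodule_def using sub bracket_in_bracket_span
    by (auto simp: bracket_span_def intro: subspace_span)
  then consider "?B = {0}" | "?B = V i" using submodule_V_cases[OF _ sub] by blast
  then show ?thesis
  proof cases
    case 1
    have "\<exists>a b. mult a b = Some i"
    proof (rule ccontr)
      assume no: "\<nexists>a b. mult a b = Some i"
      have hom: "component i (bracket x y) = 0" if "x \<in> homogeneous" "y \<in> homogeneous" for x y
      proof -
        have LV: "component i (bracket x y) = 0" if "x \<in> L" "y \<in> V j" for x y j
        proof (cases "j = i")
          case True
          then have "bracket x y \<in> ?B" using that by (auto intro: bracket_in_bracket_span)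
          then show ?thesis using 1 by (simp add: component_simps)
        qed (use component_V[OF bracket_L_V[OF that]] in auto)
        have VV: "component i (bracket x y) = 0" if "x \<in> V j" "y \<in> V j'" for x y j j'
          using that no by (intro component_bracket_ne) auto
        have VL: "component i (bracket x y) = 0" if "x \<in> V j" "y \<in> L" for x y j
          using LV[OF that(2,1)] bracket_antisym[of x y] by (simp add: component_simps)
        show ?thesis
          using that LV VL VV bracket_L_L component_L unfolding homogeneous_def by blast
      qed
      have all: "component i (bracket x y) = 0" for x y
      proof -
        have "component i (bracket x y) = 0" if "x \<in> homogeneous" for x
          by (rule lin_eq_0_span[OF lin_compose[OF component_lin linear_bracket_right] hom span_homogeneous])
            (use that in auto)
        then show ?thesis
          by (rule lin_eq_0_span[OF lin_compose[OF component_lin linear_bracket_left] _ span_homogeneous])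
      qed
      obtain v where v: "v \<in> V i" "v \<noteq> 0" by (rule V_nonzero)
      have "v \<in> span {bracket a b | a b. a \<in> UNIV \<and> b \<in> UNIV}"
        using symp unfolding sympathetic_def bracket_span_def by blast
      then have "component i v = 0"
        by (rule lin_eq_0_span[OF component_lin, rotated]) (use all in auto)
      then show False using v by (simp add: component_V)
    qed
    then show ?thesis using 1 by blast
  qed simp
qed

end

section \<open>Nilpotency of the radical\<close>

context sympathetic_sum
begin

text \<open>The labels occurring in the bracket of the sum over \<open>A\<close> with the sum over
  \<open>T\<close>.\<close>

definition act :: "'i set \<Rightarrow> 'i set \<Rightarrow> 'i set" where
  "act A T = {c. \<exists>i\<in>A. \<exists>j\<in>T. mult i j = Some c}"

text \<open>The sum over \<open>A\<close> is then an ideal of the whole algebra, since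
  \<open>L\<close> preserves each summand.\<close>

definition label_ideal :: "'i set \<Rightarrow> bool" where
  "label_ideal A \<longleftrightarrow> act UNIV A \<subseteq> A"

text \<open>For finitely many labels this says that the iterates of \<open>act A\<close>, started at
  \<open>UNIV\<close>, reach the empty set. The form without iteration suits an argument about the
  greatest such \<open>T\<close>.\<close>

definition acts_nilpotently :: "'i set \<Rightarrow> bool" where
  "acts_nilpotently A \<longleftrightarrow> (\<forall>T. T \<subseteq> act A T \<longrightarrow> T = {})"

text \<open>Monotonicity gives the greatest \<open>T\<close> with
  \<open>T \<subseteq> act A T\<close> as a union.\<close>

lemma act_mono: "A \<subseteq> A' \<Longrightarrow> T \<subseteq> T' \<Longrightarrow> act A T \<subseteq> act A' T'"
  unfolding act_def by blast

lemma act_commute: "act A T = act T A"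
  unfolding act_def using mult_commute by fastforce

lemma act_jacobi: "act X (act A T) \<subseteq> act A (act X T) \<union> act (act X A) T"
proof
  fix c assume "c \<in> act X (act A T)"
  then obtain x a t e where m: "x \<in> X" "a \<in> A" "t \<in> T" "mult a t = Some e" "mult e x = Some c"
    unfolding act_def using mult_commute by fastforce
  from mult_jacobi[OF m(4,5)] consider f where "mult x t = Some f" "mult a f = Some c"
    | f where "mult x a = Some f" "mult f t = Some c"
    by (auto simp: mult_commute)
  then show "c \<in> act A (act X T) \<union> act (act X A) T"
    using m(1-3) unfolding act_def by cases blast+
qed

lemma label_ideal_act: "label_ideal A \<Longrightarrow> label_ideal T \<Longrightarrow> label_ideal (act A T)"
  using act_jacobi[of UNIV A T] act_mono[of A A "act UNIV T" T] act_mono[of "act UNIV A" A T T]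
  unfolding label_ideal_def by blast

section \<open>Nilpotent action of ideals, by compression to subquotients\<close>

definition proj :: "'i set \<Rightarrow> 'a \<Rightarrow> 'a" where
  "proj W x = (\<Sum>j\<in>W. component j x)"

lemma proj_lin: "lin (proj W)"
  unfolding proj_def by (rule linI) (simp_all add: component_simps sum.distrib scale_sum_right)

lemmas proj_simps = lin_simps[OF proj_lin]

lemma proj_V: "v \<in> V j \<Longrightarrow> proj W v = (if j \<in> W then v else 0)"
  by (simp add: proj_def component_V)

lemma homogeneous_step:
  assumes "y \<in> homogeneous" "v \<in> V j"
  obtains j' where "bracket y v \<in> V j'" "\<And>I. label_ideal I \<Longrightarrow> j \<in> I \<Longrightarrow> j' \<in> I"
proof -
  consider "y \<in> L" | i where "y \<in> V i" using assms unfolding homogeneous_def by blast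
  then show ?thesis
  proof cases
    case 1
    then show ?thesis using that bracket_L_V assms by blast
  next
    case 2
    show ?thesis
    proof (cases "mult i j")
      case None
      \<comment> \<open>The bracket is zero and lies in every summand; the label \<open>j\<close>
        itself is chosen because it also meets the condition on ideals.\<close>
      then show ?thesis
        using that[of j] bracket_None[OF None 2 assms(2)] subspace_0[OF subspace_V] by simp
    next
      case (Some c)
      have "bracket y v \<in> V c" by (rule bracket_Some[OF Some 2 assms(2)])
      then show ?thesis using that[of c] Some unfolding label_ideal_def act_def by blast
    qed
  qed
qed

text \<open>Elements \<open>x = [a, y]\<close> for which \<open>[x, y]\<close> acts as zero wherever
  \<open>B\<close> does, which is the commutation hypothesis of Jacobson's lemma. The disjunct with
  zero covers an empty \<open>B\<close>.\<close>

definition nilpotent_generators :: "'i set \<Rightarrow> 'i \<Rightarrow> 'a set" where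
  "nilpotent_generators B i = {bracket a y | a y. a \<in> homogeneous \<and> y \<in> homogeneous \<and>
    bracket a y \<in> V i \<and>
    (bracket (bracket a y) y = 0 \<or> (\<exists>b\<in>B. bracket (bracket a y) y \<in> V b))}"

text \<open>The largest \<open>T\<close> with \<open>T \<subseteq> act A T\<close> is closed under products with all labels. On the quotient of
  \<open>\<Oplus>T\<close> by \<open>\<Oplus>act B T\<close> the generators are nilpotent by Jacobson's lemma, and the summands with label in
  \<open>A\<close> commute. The quotient is modelled by compressing with the projection onto the labels in
  \<open>T - act B T\<close>.\<close>

lemma acts_nilpotently_step:
  assumes A: "label_ideal A" and B: "label_ideal B" "acts_nilpotently B" and AA: "act A A \<subseteq> B"
    and gen: "\<And>i. i \<in> A \<Longrightarrow> V i \<subseteq> span (nilpotent_generators B i)"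
  shows "acts_nilpotently A"
proof -
  define T where "T = \<Union>{T. T \<subseteq> act A T}"
  have T_greatest: "T' \<subseteq> T" if "T' \<subseteq> act A T'" for T' using that unfolding T_def by blast
  have TA: "T \<subseteq> act A T"
  proof
    fix x assume "x \<in> T"
    then obtain T' where T': "T' \<subseteq> act A T'" "x \<in> T'" unfolding T_def by blast
    then show "x \<in> act A T" using act_mono[OF order_refl T_greatest[OF T'(1)], of A] by blast
  qed
  \<comment> \<open>By \<open>act_jacobi\<close>, the set \<open>T \<union> act UNIV T\<close> is
    again contained in its image under \<open>act A\<close>, so it lies in the greatest such
    set.\<close>
  have T: "label_ideal T"
  proof -
    have "act UNIV T \<subseteq> act UNIV (act A T)" using TA by (intro act_mono) auto
    also have "\<dots> \<subseteq> act A (act UNIV T) \<union> act (act UNIV A) T" by (rule act_jacobi)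
    also have "\<dots> \<subseteq> act A (T \<union> act UNIV T)"
      using A act_mono[of A A "act UNIV T" "T \<union> act UNIV T"] act_mono[of "act UNIV A" A T "T \<union> act UNIV T"]
      unfolding label_ideal_def by blast
    finally have "T \<union> act UNIV T \<subseteq> act A (T \<union> act UNIV T)"
      using TA act_mono[of A A T "T \<union> act UNIV T"] by blast
    then show ?thesis using T_greatest unfolding label_ideal_def by blast
  qed
  define R where "R = act B T"
  have R: "label_ideal R" unfolding R_def by (rule label_ideal_act[OF B(1) T])
  define W where "W = T - R"
  define \<rho> where "\<rho> y v = proj W (bracket y (proj W v))" for y v
  have \<rho>_lin: "lin (\<rho> y)" for y
    unfolding \<rho>_def by (rule lin_compose[OF proj_lin lin_compose[OF linear_bracket_right proj_lin]])
  have \<rho>_lin_left: "lin (\<lambda>y. \<rho> y v)" for v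
    unfolding \<rho>_def by (rule lin_compose[OF proj_lin linear_bracket_left])
  have proj_ext: "f (proj W v) = g (proj W v)"
    if "lin f" "lin g" "\<And>j v. j \<in> W \<Longrightarrow> v \<in> V j \<Longrightarrow> f v = g v" for f g :: "'a \<Rightarrow> 'a" and v
    unfolding proj_def by (simp add: lin_simps[OF that(1)] lin_simps[OF that(2)] that(3))
  \<comment> \<open>Compression is multiplicative here: since \<open>T\<close> is an ideal, whatever
    leaves \<open>W\<close> enters \<open>R\<close>, and since \<open>R\<close> is an ideal it never
    returns.\<close>
  have mult\<rho>: "\<rho> y (\<rho> z v) = proj W (bracket y (bracket z (proj W v)))"
    if y: "y \<in> homogeneous" and z: "z \<in> homogeneous" for y z v
  proof -
    have "proj W (bracket y (proj W (proj W (bracket z (proj W v))))) =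
      proj W (bracket y (bracket z (proj W v)))"
    proof (rule proj_ext[of "\<lambda>u. proj W (bracket y (proj W (proj W (bracket z u))))"
          "\<lambda>u. proj W (bracket y (bracket z u))"])
      fix j u assume j: "j \<in> W" "u \<in> V j"
      obtain j' where j': "bracket z u \<in> V j'" "\<And>I. label_ideal I \<Longrightarrow> j \<in> I \<Longrightarrow> j' \<in> I"
        using homogeneous_step[OF z j(2)] by metis
      show "proj W (bracket y (proj W (proj W (bracket z u)))) = proj W (bracket y (bracket z u))"
      proof (cases "j' \<in> W")
        case True
        then show ?thesis using j' by (simp add: proj_V)
      next
        case False
        then have "j' \<in> R" using j'(2)[OF T] j(1) unfolding W_def by blast
        obtain l where l: "bracket y (bracket z u) \<in> V l" "\<And>I. label_ideal I \<Longrightarrow> j' \<in> I \<Longrightarrow> l \<in> I"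
          using homogeneous_step[OF y j'(1)] by metis
        then have "l \<notin> W" using l(2)[OF R \<open>j' \<in> R\<close>] unfolding W_def by blast
        then show ?thesis using l(1) j'(1) False by (simp add: proj_V proj_simps bracket_simps)
      qed
    qed (intro lin_compose[OF proj_lin] lin_compose[OF linear_bracket_right] linear_bracket_right)+
    then show ?thesis by (simp add: \<rho>_def)
  qed
  have \<rho>_bracket: "\<rho> (bracket y z) v = \<rho> y (\<rho> z v) - \<rho> z (\<rho> y v)"
    if "y \<in> homogeneous" "z \<in> homogeneous" for y z v
    using that by (simp add: mult\<rho>) (simp add: \<rho>_def bracket_bracket_left proj_simps)
  have \<rho>_B: "\<rho> z v = 0" if "z \<in> V b" "b \<in> B" for z b v
    unfolding \<rho>_def
  proof (rule proj_ext[of "\<lambda>u. proj W (bracket z u)" "\<lambda>_. 0"])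
    fix j u assume j: "j \<in> W" "u \<in> V j"
    show "proj W (bracket z u) = 0"
    proof (cases "mult b j")
      case None
      then show ?thesis using bracket_None that j by (simp add: proj_simps)
    next
      case (Some c)
      then have "c \<notin> W" using that j unfolding W_def R_def act_def by blast
      then show ?thesis using bracket_Some[OF Some that(1) j(2)] by (simp add: proj_V)
    qed
  qed (intro lin_compose[OF proj_lin] linear_bracket_right endo.linear_zero)+
  \<comment> \<open>Only finitely many operators are allowed in
    \<open>commuting_nilpotent_family\<close>. A maximal independent set of generators is finite,
    has the same span, and its members are still brackets of the required shape.\<close>
  obtain E where E: "E \<subseteq> (\<Union>i\<in>A. nilpotent_generators B i)" "independent E"
    "(\<Union>i\<in>A. nilpotent_generators B i) \<subseteq> span E"
    using maximal_independent_subset[of "\<Union>i\<in>A. nilpotent_generators B i"] by blast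
  have fin: "finite E" using E(2) by (rule finite_independent)
  have nil: "\<exists>d. \<forall>v. (\<rho> x ^^ d) v = 0" if "x \<in> E" for x
  proof -
    from that E(1) obtain i where "i \<in> A" "x \<in> nilpotent_generators B i" by blast
    then obtain a y where x: "x = bracket a y" "a \<in> homogeneous" "y \<in> homogeneous" "x \<in> V i"
      "bracket x y = 0 \<or> (\<exists>b\<in>B. bracket x y \<in> V b)"
      unfolding nilpotent_generators_def by blast
    show ?thesis
    proof (rule nilpotent_commutator[OF \<rho>_lin \<rho>_lin])
      show "\<rho> x v = \<rho> a (\<rho> y v) - \<rho> y (\<rho> a v)" for v using x by (simp add: \<rho>_bracket)
      have "\<rho> (bracket x y) v = 0" for v
        using x(5) \<rho>_B lin_simps(4)[OF \<rho>_lin_left] by auto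
      then show "\<rho> x (\<rho> y v) = \<rho> y (\<rho> x v)" for v
        using \<rho>_bracket[OF homogeneous_V[OF x(4)] x(3)] by simp
    qed
  qed
  have comm: "\<rho> x (\<rho> y v) = \<rho> y (\<rho> x v)" if x: "x \<in> V i" "i \<in> A" and y: "y \<in> V j" "j \<in> A" for x y v i j
  proof -
    have "\<rho> (bracket x y) v = 0"
    proof (cases "mult i j")
      case None
      then show ?thesis using bracket_None[OF None x(1) y(1)] lin_simps(4)[OF \<rho>_lin_left] by simp
    next
      case (Some c)
      then have "c \<in> B" using AA x y unfolding act_def by blast
      then show ?thesis using bracket_Some[OF Some x(1) y(1)] \<rho>_B by blast
    qed
    then show ?thesis
      using \<rho>_bracket[OF homogeneous_V[OF x(1)] homogeneous_V[OF y(1)]] by simp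
  qed
  define U where "U = (\<Union>j\<in>W. V j)"
  have U: "U \<subseteq> span (\<Union>f\<in>\<rho> ` E. f ` U)"
  proof
    fix v assume "v \<in> U"
    then obtain c where c: "c \<in> W" "v \<in> V c" unfolding U_def by blast
    then obtain i j where ij: "i \<in> A" "j \<in> T" "mult i j = Some c"
      using TA unfolding W_def act_def by blast
    \<comment> \<open>A factor in the ideal \<open>R\<close> would put the product \<open>c\<close>
      into \<open>R\<close> as well, so products that reach \<open>W\<close> start in
      \<open>W\<close>.\<close>
    have "j \<in> W"
    proof (rule ccontr)
      assume "j \<notin> W"
      then have "c \<in> R" using R ij unfolding W_def label_ideal_def act_def by blast
      then show False using c unfolding W_def by blast
    qed
    have "bracket u w \<in> span (\<Union>f\<in>\<rho> ` E. f ` U)" if u: "u \<in> V i" and w: "w \<in> V j" for u w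
    proof -
      have "u \<in> span (nilpotent_generators B i)" using gen[OF ij(1)] u by blast
      also have "\<dots> \<subseteq> span E" using E(3) ij(1) by (intro span_minimal subspace_span) blast
      finally have "(\<lambda>u. \<rho> u w) u \<in> span ((\<lambda>u. \<rho> u w) ` E)" by (rule lin_image_span[OF \<rho>_lin_left])
      also have "\<dots> \<subseteq> span (\<Union>f\<in>\<rho> ` E. f ` U)"
        by (rule span_mono) (use w \<open>j \<in> W\<close> in \<open>auto simp: U_def\<close>)
      finally show ?thesis
        using w \<open>j \<in> W\<close> c bracket_Some[OF ij(3) u w] by (simp add: \<rho>_def proj_V)
    qed
    then have "V c \<subseteq> span (\<Union>f\<in>\<rho> ` E. f ` U)"
      using bracket_span_subset[OF subspace_span] mult_Some[OF ij(3)] by blast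
    then show "v \<in> span (\<Union>f\<in>\<rho> ` E. f ` U)" using c by blast
  qed
  have E_V: "\<exists>i\<in>A. x \<in> V i" if "x \<in> E" for x
    using that E(1) unfolding nilpotent_generators_def by blast
  have "U \<subseteq> {0}"
  proof (rule commuting_nilpotent_family[of "\<rho> ` E", OF _ _ _ _ U])
    fix f g v assume "f \<in> \<rho> ` E" "g \<in> \<rho> ` E"
    then obtain x y where "f = \<rho> x" "g = \<rho> y" "x \<in> E" "y \<in> E" by blast
    then show "f (g v) = g (f v)" using E_V[of x] E_V[of y] comm by auto
  qed (use fin \<rho>_lin nil in auto)
  have "W = {}"
  proof (rule ccontr)
    assume "W \<noteq> {}"
    then obtain j where "j \<in> W" by blast
    moreover obtain v where "v \<in> V j" "v \<noteq> 0" by (rule V_nonzero)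
    ultimately show False using \<open>U \<subseteq> {0}\<close> unfolding U_def by blast
  qed
  then have "T \<subseteq> act B T" unfolding W_def R_def by blast
  then have "T = {}" using B(2) unfolding acts_nilpotently_def by blast
  then show ?thesis using T_greatest unfolding acts_nilpotently_def by blast
qed

text \<open>Otherwise the summands with label in \<open>A\<close> would survive in every term of the
  derived series, against solvability of \<open>H\<close>.\<close>

lemma act_self_ne:
  assumes "A \<noteq> {}"
  shows "act A A \<noteq> A"
proof
  assume A: "act A A = A"
  have "V i \<subseteq> derived_series H r" if "i \<in> A" for i r
    using that
  proof (induction r arbitrary: i)
    case 0
    then show ?case using V_subset_H by auto
  next
    case (Suc r)
    then obtain a b where ab: "a \<in> A" "b \<in> A" "mult a b = Some i" using A unfolding act_def by blast
    have "bracket_span (V a) (V b) \<subseteq> bracket_span (derived_series H r) (derived_series H r)"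
      unfolding bracket_span_def by (rule span_mono) (use Suc.IH ab in blast)
    then show ?case using mult_Some[OF ab(3)] by simp
  qed
  moreover obtain r where "derived_series H r = {0}"
    using levi unfolding levi_decomposition_def is_radical_def solvable_def by blast
  moreover obtain i where "i \<in> A" using assms by blast
  moreover obtain v where "v \<in> V i" "v \<noteq> 0" by (rule V_nonzero)
  ultimately show False by blast
qed

text \<open>Solvability makes \<open>act A A\<close> a strictly smaller ideal, so the induction
  hypothesis applies to it. The set \<open>N\<close> lies between it and \<open>A\<close>: for a
  label of \<open>N\<close> the second factor \<open>c\<close> of a product can be taken in
  \<open>A\<close>, so the double brackets fall into \<open>act A A\<close>; for a general label of
  \<open>A\<close> they fall into \<open>act A UNIV\<close>, which is inside
  \<open>N\<close>.\<close>

lemma acts_nilpotently_ideal: "label_ideal A \<Longrightarrow> acts_nilpotently A"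
proof (induction "card A" arbitrary: A rule: less_induct)
  case less
  show ?case
  proof (cases "A = {}")
    case True
    then show ?thesis unfolding acts_nilpotently_def act_def by blast
  next
    case False
    \<comment> \<open>The ideal \<open>[A, \<gg>]\<close>: each \<open>V i\<close> outside of it is a trivial module, hence a product.\<close>
    define N where "N = {i \<in> A. V i = bracket_span L (V i)} \<union> act UNIV A"
    have A: "act UNIV A \<subseteq> A" using less.prems unfolding label_ideal_def .
    have AA: "act A A \<subseteq> A" using A act_mono[of A UNIV A A] by blast
    then have "card (act A A) < card A" using act_self_ne[OF False] by (intro psubset_card_mono) auto
    then have nil: "acts_nilpotently (act A A)"
      using less.hyps label_ideal_act[OF less.prems less.prems] by blast
    have NA: "N \<subseteq> A" using A unfolding N_def by blast
    have N: "label_ideal N"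
      unfolding label_ideal_def using act_mono[of UNIV UNIV N A] NA unfolding N_def by blast
    have sub: "bracket_span X Y \<subseteq> span (nilpotent_generators C i)"
      if "bracket_span X Y = V i" "X \<subseteq> homogeneous" "Y \<subseteq> V j" "\<And>c. mult i j = Some c \<Longrightarrow> c \<in> C"
      for X Y i j C
      unfolding bracket_span_def
    proof (rule span_mono, rule subsetI)
      fix x assume "x \<in> {bracket a y | a y. a \<in> X \<and> y \<in> Y}"
      then obtain a y where x: "x = bracket a y" and ay: "a \<in> X" "y \<in> Y" by blast
      have V: "bracket a y \<in> V i" using bracket_in_bracket_span[OF ay] that(1) by simp
      have "y \<in> V j" using ay that(3) by blast
      have "bracket (bracket a y) y = 0 \<or> (\<exists>b\<in>C. bracket (bracket a y) y \<in> V b)"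
      proof (cases "mult i j")
        case None
        then show ?thesis using bracket_None[OF None V \<open>y \<in> V j\<close>] by blast
      next
        case (Some c)
        then show ?thesis using bracket_Some[OF Some V \<open>y \<in> V j\<close>] that(4) by blast
      qed
      then show "x \<in> nilpotent_generators C i"
        unfolding x nilpotent_generators_def using V ay that(2) homogeneous_V[OF \<open>y \<in> V j\<close>] by blast
    qed
    have VH: "V i \<subseteq> homogeneous" for i using homogeneous_V by blast
    have LH: "L \<subseteq> homogeneous" using homogeneous_L by blast
    have gen_L: "V i \<subseteq> span (nilpotent_generators C i)"
      if "V i = bracket_span L (V i)" "i \<in> A" "act A A \<subseteq> C" for i C
      using sub[OF that(1)[symmetric] LH order_refl, of C] that unfolding act_def by blast
    have gen_V: "V i \<subseteq> span (nilpotent_generators C i)"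
      if "mult d c = Some i" "act {i} {c} \<subseteq> C" for d c i C
      using sub[OF mult_Some[OF that(1)] VH order_refl, of C] mult_Some[OF that(1)] that(2)
      unfolding act_def by blast
    have "acts_nilpotently N"
    proof (rule acts_nilpotently_step[OF N label_ideal_act[OF less.prems less.prems] nil])
      show "act N N \<subseteq> act A A" by (intro act_mono NA)
      fix i assume i: "i \<in> N"
      then consider "V i = bracket_span L (V i)" | d c where "c \<in> A" "mult d c = Some i"
        unfolding N_def act_def by blast
      then show "V i \<subseteq> span (nilpotent_generators (act A A) i)"
      proof cases
        case 1
        then show ?thesis using gen_L i NA by blast
      next
        case 2
        have "act {i} {c} \<subseteq> act A A" by (rule act_mono) (use i NA 2 in auto)
        then show ?thesis by (rule gen_V[OF 2(2)])
      qed
    qed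
    show ?thesis
    proof (rule acts_nilpotently_step[OF less.prems N \<open>acts_nilpotently N\<close>])
      show AN: "act A A \<subseteq> N" using act_mono[of A UNIV A A] unfolding N_def by blast
      fix i assume i: "i \<in> A"
      consider "V i = bracket_span L (V i)" | d c where "mult d c = Some i"
        using V_generated[of i] by blast
      then show "V i \<subseteq> span (nilpotent_generators N i)"
      proof cases
        case 1
        then show ?thesis using gen_L i AN by blast
      next
        case 2
        have "act {i} {c} \<subseteq> act A UNIV" by (rule act_mono) (use i in auto)
        also have "\<dots> \<subseteq> N" unfolding N_def act_commute[of A] by blast
        finally show ?thesis by (rule gen_V[OF 2])
      qed
    qed
  qed
qed

text \<open>This is nilpotency of the radical. Read contrapositively, each nonempty set of labels
  has a member that is not a product with a factor in the set.\<close>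

lemma product_nilpotent: "T \<subseteq> act UNIV T \<Longrightarrow> T = {}"
  using acts_nilpotently_ideal[of UNIV] unfolding acts_nilpotently_def label_ideal_def by blast

end

section \<open>Rigidity of weights and the centre of the radical\<close>

context sympathetic_sum
begin

lemma centre_L_trivial:
  assumes "x \<in> L" "\<And>y. y \<in> L \<Longrightarrow> bracket x y = 0"
  shows "x = 0"
proof -
  let ?Z = "{z \<in> L. \<forall>y\<in>L. bracket z y = 0}"
  have "ideal_of ?Z L"
    unfolding ideal_of_def
  proof (intro conjI ballI)
    show "subspace ?Z"
      using subspace_L unfolding subspace_def by (auto simp: bracket_simps)
    fix y z assume "y \<in> L" "z \<in> ?Z"
    moreover from this have "bracket y z = 0" using bracket_antisym[of y z] by simp
    ultimately show "bracket y z \<in> ?Z" using subspace_0[OF subspace_L] by (simp add: bracket_simps)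
  qed auto
  then consider "?Z = {0}" | "?Z = L" using simple_L unfolding simple_subalgebra_def by blast
  then show ?thesis
  proof cases
    case 1
    then show ?thesis using assms by blast
  next
    case 2
    then have "\<forall>x\<in>L. \<forall>y\<in>L. bracket x y = 0" by blast
    then have "bracket_span L L = {0}" using bracket_span_nonzero[of L L] by blast
    then show ?thesis using simple_L unfolding simple_subalgebra_def by blast
  qed
qed

text \<open>Weights compatible with the products define a derivation; it is inner, but an inner derivation
  that vanishes on \<open>L\<close> has no diagonal part on \<open>H\<close>.\<close>

lemma weights_zero:
  fixes w :: "'i \<Rightarrow> complex"
  assumes w: "\<And>i j c. mult i j = Some c \<Longrightarrow> w i + w j = w c"
  shows "w i = 0"
proof -
  define D where "D x = (\<Sum>i\<in>UNIV. scale (w i) (component i x))" for x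
  have D_lin: "lin D"
    unfolding D_def
    by (rule linI) (simp_all add: component_simps sum.distrib scale_right_distrib scale_sum_right mult.commute)
  have D_L: "D x = 0" if "x \<in> L" for x using that by (simp add: D_def component_L)
  have D_V: "D v = scale (w i) v" if "v \<in> V i" for v i
  proof -
    have "D v = (\<Sum>j\<in>UNIV. if j = i then scale (w i) v else 0)"
      unfolding D_def using that by (intro sum.cong) (auto simp: component_V)
    then show ?thesis by simp
  qed
  \<comment> \<open>The defect of the Leibniz rule is bilinear, so it need only vanish on
    homogeneous pairs.\<close>
  define d where "d x y = D (bracket x y) - bracket (D x) y - bracket x (D y)" for x y
  have d_left: "lin (\<lambda>x. d x y)" and d_right: "lin (\<lambda>y. d x y)" for x y
    unfolding d_def
    by (intro endo.linear_compose_sub lin_compose[OF D_lin] lin_compose[OF _ D_lin]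
        lin_compose[OF linear_bracket_left D_lin] lin_compose[OF linear_bracket_right D_lin]
        linear_bracket_left linear_bracket_right)+
  have LV: "d x y = 0" if "x \<in> L" "y \<in> V i" for x y i
    using that D_V[OF bracket_L_V[OF that]] by (simp add: d_def D_L D_V bracket_simps)
  have d_anti: "d y x = - d x y" for x y
    using bracket_antisym[of y x] bracket_antisym[of "D y" x] bracket_antisym[of y "D x"]
    by (simp add: d_def lin_simps[OF D_lin])
  have VV: "d x y = 0" if "x \<in> V i" "y \<in> V j" for x y i j
  proof (cases "mult i j")
    case None
    then show ?thesis
      using that bracket_None[OF None that] by (simp add: d_def D_V bracket_simps lin_simps[OF D_lin])
  next
    case (Some c)
    then show ?thesis
      using that D_V[OF bracket_Some[OF Some that]] w[OF Some, symmetric]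
      by (simp add: d_def D_V bracket_simps scale_left_distrib)
  qed
  have "d x y = 0" if xy: "x \<in> homogeneous" "y \<in> homogeneous" for x y
  proof -
    consider "x \<in> L" "y \<in> L" | i where "x \<in> L" "y \<in> V i" | i where "x \<in> V i" "y \<in> L"
      | i j where "x \<in> V i" "y \<in> V j"
      using xy unfolding homogeneous_def by blast
    then show ?thesis
    proof cases
      case 1
      then show ?thesis by (simp add: d_def D_L bracket_L_L bracket_simps)
    next
      case 3
      then show ?thesis using d_anti[of x y] LV by simp
    qed (use LV VV in blast)+
  qed
  then have "d x y = 0" if "x \<in> homogeneous" for x y
    using lin_eq_0_span[OF d_right _ span_homogeneous] that by blast
  then have "d x y = 0" for x y
    using lin_eq_0_span[OF d_left _ span_homogeneous] by blast
  then have "derivation D"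
    using D_lin by (auto simp: derivation_def d_def algebra_simps)
  then have "D \<in> range ad" using symp unfolding sympathetic_def by blast
  then obtain x where x: "\<And>y. D y = bracket x y" unfolding ad_def by blast
  define l where "l = x - (\<Sum>i\<in>UNIV. component i x)"
  have l: "l \<in> L" unfolding l_def by (rule component_rest)
  have xy: "bracket x y = bracket l y + (\<Sum>i\<in>UNIV. bracket (component i x) y)" for y
    by (simp add: l_def bracket_simps)
  \<comment> \<open>\<open>D\<close> kills \<open>y\<close>, so \<open>[x, y] = 0\<close>. Its part
    in \<open>L\<close> is \<open>[l, y]\<close> and its other parts are the brackets of the
    components, so all of them vanish separately.\<close>
  have "bracket l y = 0" if y: "y \<in> L" for y
  proof -
    have e: "bracket (component i x) y \<in> V i" for i
      using bracket_L_V[OF y component_in, of i x] bracket_antisym[of "component i x" y]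
        subspace_neg[OF subspace_V] by simp
    have *: "0 = bracket l y + (\<Sum>i\<in>UNIV. bracket (component i x) y)"
      using D_L[OF y] x xy by metis
    have "- (\<Sum>i\<in>UNIV. bracket (component i x) y) = bracket l y"
      using * by (metis neg_eq_iff_add_eq_0 add.commute)
    then have "component i 0 = bracket (component i x) y" for i
      using bracket_L_L[OF l y] by (intro component_eqI[OF e]) simp
    then have "bracket (component i x) y = 0" for i by (simp add: component_simps)
    then show ?thesis using * by simp
  qed
  then have "l = 0" using centre_L_trivial[OF l] by blast
  obtain v where v: "v \<in> V i" "v \<noteq> 0" by (rule V_nonzero)
  \<comment> \<open>Nilpotency, applied to a single label: no bracket with a summand maps
    \<open>V i\<close> to itself, so \<open>ad x\<close> has no diagonal part.\<close>
  have ne: "mult j i \<noteq> Some i" for j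
    using product_nilpotent[of "{i}"] unfolding act_def by blast
  have "component i (D v) = 0"
    unfolding x xy \<open>l = 0\<close>
    using component_bracket_ne[OF ne component_in v(1)] by (simp add: component_simps bracket_simps)
  then have "scale (w i) v = 0"
    using v component_V[OF subspace_scale[OF subspace_V v(1)]] by (simp add: D_V)
  then show ?thesis using v by simp
qed

text \<open>In \<open>[z, y] = 0\<close> the contributions of several components to
  \<open>V c\<close> might cancel. The hypothesis \<open>others\<close> leaves only that of
  \<open>component i z\<close>, which therefore annihilates \<open>V j\<close>. The annihilator of
  \<open>V j\<close> in \<open>V i\<close> is a submodule and not all of \<open>V i\<close>, hence
  zero.\<close>

lemma centre_H_component:
  assumes z: "z \<in> centre H" and m: "mult i j = Some c"
    and others: "\<And>i'. i' \<noteq> i \<Longrightarrow> mult i' j = Some c \<Longrightarrow> component i' z = 0"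
  shows "component i z = 0"
proof -
  have ann: "bracket (component i z) y = 0" if y: "y \<in> V j" for y
  proof -
    have "bracket z y = 0" using z y V_subset_H unfolding centre_def by blast
    then have "0 = component c (bracket z y)" by (simp add: component_simps)
    also have "z = (\<Sum>i\<in>UNIV. component i z)"
      using component_H z by (simp add: centre_def)
    also have "component c (bracket (\<Sum>i\<in>UNIV. component i z) y) =
      (\<Sum>i'\<in>UNIV. component c (bracket (component i' z) y))"
      by (simp add: bracket_simps component_simps)
    also have "\<dots> = (\<Sum>i'\<in>UNIV. if i' = i then bracket (component i z) y else 0)"
    proof (rule sum.cong)
      fix i'
      show "component c (bracket (component i' z) y) = (if i' = i then bracket (component i z) y else 0)"
      proof (cases "i' = i")
        case True
        then show ?thesis using component_V[OF bracket_Some[OF m component_in y]] by simp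
      next
        case False
        then show ?thesis
          using component_bracket_ne[OF _ component_in y, of i' c z] others[OF False]
          by (cases "mult i' j = Some c") (auto simp: bracket_simps component_simps)
      qed
    qed simp
    finally show ?thesis by simp
  qed
  let ?Z = "{v \<in> V i. \<forall>y\<in>V j. bracket v y = 0}"
  have "submodule L ?Z"
    unfolding submodule_def
  proof (intro conjI ballI)
    show "subspace ?Z" using subspace_V[of i] unfolding subspace_def by (auto simp: bracket_simps)
    fix x v assume "x \<in> L" "v \<in> ?Z"
    then show "bracket x v \<in> ?Z" using bracket_L_V by (auto simp: bracket_bracket_left bracket_simps)
  qed
  then have "?Z = {0} \<or> ?Z = V i" by (rule submodule_V_cases) blast
  moreover have "?Z \<noteq> V i"
    using mult_Some_nonzero[OF m] by blast
  moreover have "component i z \<in> ?Z" using ann by simp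
  ultimately show ?thesis by blast
qed

text \<open>\<open>N\<close> stands for the set of labels at which a central element has a nonzero
  component. By \<open>centre_H_component\<close>, each product with a label of \<open>N\<close>
  must be matched by another label of \<open>N\<close>, so that cancellation is possible; the centre
  is thus computed from the table alone.\<close>

lemma centre_H_eq:
  assumes c: "\<And>i. mult i c = None"
    and N: "\<And>N. (\<And>i j e. i \<in> N \<Longrightarrow> mult i j = Some e \<Longrightarrow>
        \<exists>i'\<in>N. i' \<noteq> i \<and> mult i' j = Some e) \<Longrightarrow> N \<subseteq> {c}"
  shows "centre H = V c"
proof
  show "centre H \<subseteq> V c"
  proof
    fix z assume z: "z \<in> centre H"
    have "{i. component i z \<noteq> 0} \<subseteq> {c}"
      by (rule N) (use centre_H_component[OF z] in blast)
    then have "(\<Sum>i\<in>UNIV. component i z) = (\<Sum>i\<in>UNIV. if i = c then component c z else 0)"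
      by (intro sum.cong) auto
    then have "z = component c z" using component_H z by (simp add: centre_def)
    then show "z \<in> V c" by (metis component_in)
  qed
  show "V c \<subseteq> centre H"
  proof
    fix z assume z: "z \<in> V c"
    have "bracket z x = 0" if x: "x \<in> H" for x
    proof -
      have "bracket z x = bracket z (\<Sum>i\<in>UNIV. component i x)" using component_H[OF x] by simp
      also have "\<dots> = (\<Sum>i\<in>UNIV. bracket z (component i x))" by (simp add: bracket_simps)
      also have "\<dots> = 0" using bracket_None[OF _ z component_in] c by (simp add: mult_commute)
      finally show ?thesis .
    qed
    then show "z \<in> centre H" using z V_subset_H unfolding centre_def by blast
  qed
qed

lemma derived_H_direct_sum:
  fixes \<sigma> :: "'j \<Rightarrow> 'i"
  assumes fin: "finite I" and inj: "inj_on \<sigma> I"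
    and prod: "{c. \<exists>i j. mult i j = Some c} = \<sigma> ` I"
  shows "is_direct_sum I (V \<circ> \<sigma>) (bracket_span H H)"
  unfolding is_direct_sum_def
proof (intro conjI ballI allI impI)
  \<comment> \<open>The sum of the summands in question, described by the vanishing of all other
    components, which is what brackets can be tested against.\<close>
  let ?S = "{x \<in> H. \<forall>c. c \<notin> \<sigma> ` I \<longrightarrow> component c x = 0}"
  have sub_H: "subspace H"
    using levi unfolding levi_decomposition_def is_radical_def ideal_of_def by blast
  have "bracket_span H H \<subseteq> ?S"
  proof (rule bracket_span_subset)
    show "subspace ?S" using sub_H unfolding subspace_def by (auto simp: component_simps)
    fix x y assume xy: "x \<in> H" "y \<in> H"
    have "bracket x y \<in> H"
      using levi xy unfolding levi_decomposition_def is_radical_def ideal_of_def by blast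
    moreover have "component c (bracket x y) = 0" if "c \<notin> \<sigma> ` I" for c
    proof -
      have "component c (bracket (component i x) (component j y)) = 0" for i j
        by (rule component_bracket_ne[OF _ component_in component_in]) (use that prod in blast)
      moreover have "bracket x y = bracket (\<Sum>i\<in>UNIV. component i x) (\<Sum>j\<in>UNIV. component j y)"
        using xy component_H by simp
      ultimately show ?thesis by (simp add: bracket_simps component_simps)
    qed
    ultimately show "bracket x y \<in> ?S" by blast
  qed
  moreover have "x \<in> {\<Sum>i\<in>I. v i | v. \<forall>i\<in>I. v i \<in> (V \<circ> \<sigma>) i}" if x: "x \<in> ?S" for x
  proof -
    have "x = (\<Sum>c\<in>UNIV. component c x)" using component_H x by simp
    also have "\<dots> = (\<Sum>c\<in>\<sigma> ` I. component c x)"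
      by (rule sum.mono_neutral_right) (use x in auto)
    also have "\<dots> = (\<Sum>i\<in>I. component (\<sigma> i) x)" by (simp add: sum.reindex[OF inj])
    finally show ?thesis by (auto intro!: exI[of _ "\<lambda>i. component (\<sigma> i) x"])
  qed
  moreover have "(\<Sum>i\<in>I. v i) \<in> bracket_span H H" if v: "\<forall>i\<in>I. v i \<in> (V \<circ> \<sigma>) i" for v
  proof -
    have "V (\<sigma> i) \<subseteq> bracket_span H H" if i: "i \<in> I" for i
    proof -
      obtain a b where "mult a b = Some (\<sigma> i)" using prod i by blast
      then have "V (\<sigma> i) = bracket_span (V a) (V b)" using mult_Some by blast
      also have "\<dots> \<subseteq> bracket_span H H"
        unfolding bracket_span_def by (rule span_mono) (use V_subset_H in blast)
      finally show ?thesis .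
    qed
    then show ?thesis using v unfolding bracket_span_def by (intro span_sum) auto
  qed
  ultimately show "bracket_span H H = {\<Sum>i\<in>I. v i | v. \<forall>i\<in>I. v i \<in> (V \<circ> \<sigma>) i}" by blast
next
  fix v i assume v: "(\<forall>i\<in>I. v i \<in> (V \<circ> \<sigma>) i) \<and> (\<Sum>i\<in>I. v i) = 0" and i: "i \<in> I"
  have "0 = (\<Sum>j\<in>I. component (\<sigma> i) (v j))" using v by (simp add: component_simps flip: component_simps(6))
  also have "\<dots> = (\<Sum>j\<in>I. if j = i then v i else 0)"
  proof (rule sum.cong)
    fix j assume j: "j \<in> I"
    then have "v j \<in> V (\<sigma> j)" using v by simp
    then show "component (\<sigma> i) (v j) = (if j = i then v i else 0)"
      using component_V[of "v j" "\<sigma> j" "\<sigma> i"] inj_on_eq_iff[OF inj i j] by auto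
  qed simp
  also have "\<dots> = v i" using fin i by simp
  finally show "v i = 0" by simp
qed (use fin subspace_V in auto)

end

section \<open>Multiplication tables\<close>

text \<open>The counterpart of \<open>has_table\<close> for the product on labels; as an equivalence
  it also forbids every product that is not listed.\<close>

definition realizes :: "('i \<Rightarrow> 'i \<Rightarrow> 'i option) \<Rightarrow> ('j \<Rightarrow> 'i) \<Rightarrow> ('j \<times> 'j \<times> 'j) set \<Rightarrow> bool" where
  "realizes t \<sigma> T \<longleftrightarrow> (\<forall>i j c. t (\<sigma> i) (\<sigma> j) = Some (\<sigma> c) \<longleftrightarrow> (i, j, c) \<in> T \<or> (j, i, c) \<in> T)"

definition tables :: "(label \<times> label \<times> label) set set" where
  "tables = {{(n, n, p), (n, m, p), (m, m, k), (n, p, k), (m, p, k)},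
           {(n, n, k), (n, m, p), (n, p, k), (m, p, k)},
           {(n, n, k), (n, m, p), (m, m, k), (n, p, k), (m, p, k)},
           {(n, n, p), (n, m, p), (m, m, k), (n, p, k)},
           {(n, n, k), (n, m, p), (m, m, k), (n, p, k)},
           {(n, n, p), (n, m, k), (m, m, k), (n, p, k)}}"

lemma all_label: "(\<forall>i. P i) \<longleftrightarrow> P n \<and> P m \<and> P p \<and> P k"
  by (metis label.exhaust)

lemma ex_label: "(\<exists>i. P i) \<longleftrightarrow> P n \<or> P m \<or> P p \<or> P k"
  by (metis label.exhaust)

lemma tables_products:
  "T \<in> tables \<Longrightarrow> {c. \<exists>i j. (i, j, c) \<in> T \<or> (j, i, c) \<in> T} = {p, k}"
  unfolding tables_def by auto

lemma tables_k: "T \<in> tables \<Longrightarrow> (i, k, c) \<notin> T \<and> (k, i, c) \<notin> T"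
  unfolding tables_def by auto

lemma tables_centre:
  assumes "T \<in> tables"
    and "\<And>i j e. i \<in> N \<Longrightarrow> (i, j, e) \<in> T \<or> (j, i, e) \<in> T \<Longrightarrow>
      \<exists>i'. i' \<in> N \<and> i' \<noteq> i \<and> ((i', j, e) \<in> T \<or> (j, i', e) \<in> T)"
  shows "N \<subseteq> {k}"
proof -
  \<comment> \<open>In the first five tables \<open>n\<close> is the only label whose product with
    \<open>m\<close> is \<open>p\<close>; in the sixth it is the only one whose product with
    \<open>n\<close> is \<open>p\<close>. So \<open>n\<close> is excluded, then \<open>m\<close>
    through \<open>[m, n] = p\<close> or \<open>[m, m] = k\<close>, whose only rival is
    \<open>n\<close>, and then \<open>p\<close> through \<open>[p, n] = k\<close>, whose rivals are
    gone.\<close>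
  have "n \<notin> N \<and> m \<notin> N \<and> p \<notin> N"
    using assms(1) assms(2)[of m n p] assms(2)[of n m p] assms(2)[of n n p] assms(2)[of m m k]
      assms(2)[of p n k]
    unfolding tables_def insert_iff empty_iff ex_label
    by (elim disjE FalseE; simp; blast)
  then have "x \<in> {k}" if "x \<in> N" for x using that by (cases x) auto
  then show ?thesis by blast
qed

text \<open>The atom \<open>aab\<close> says that the product of \<open>a\<close> and \<open>a\<close> is \<open>b\<close>, and so on, with labels in the order
  \<open>a, b, c, d\<close>.\<close>

lemma weight_cases:
  fixes aab aac aad abc abd bbc bbd acd bcd ccd :: bool
  assumes excl: "\<not> (aab \<and> aac)" "\<not> (aab \<and> aad)" "\<not> (aac \<and> aad)" "\<not> (abc \<and> abd)" "\<not> (bbc \<and> bbd)"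
    and jac: "aab \<longrightarrow> \<not> bcd" "aac \<or> abc \<or> bbc \<longrightarrow> \<not> ccd" "aab \<and> (bbc \<or> bbd) \<longrightarrow> abc \<and> acd \<and> bbd"
      "aac \<and> bcd \<longrightarrow> abc \<and> acd" "bbc \<and> acd \<longrightarrow> abc \<and> bcd"
    and rigid: "\<And>w1 w2 w3 w4 :: complex. (aab \<longrightarrow> w1 + w1 = w2) \<and> (aac \<longrightarrow> w1 + w1 = w3) \<and>
      (aad \<longrightarrow> w1 + w1 = w4) \<and> (abc \<longrightarrow> w1 + w2 = w3) \<and> (abd \<longrightarrow> w1 + w2 = w4) \<and>
      (bbc \<longrightarrow> w2 + w2 = w3) \<and> (bbd \<longrightarrow> w2 + w2 = w4) \<and> (acd \<longrightarrow> w1 + w3 = w4) \<and>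
      (bcd \<longrightarrow> w2 + w3 = w4) \<and> (ccd \<longrightarrow> w3 + w3 = w4) \<Longrightarrow> w1 = 0 \<and> w2 = 0 \<and> w3 = 0 \<and> w4 = 0"
  shows "(aab, aac, aad, abc, abd, bbc, bbd, acd, bcd, ccd) \<in> {
      (False, False, False, True, False, False, True, True, True, False),
      (True, False, False, False, True, False, False, True, False, True),
      (False, True, False, True, False, False, True, True, False, False),
      (False, True, False, True, False, False, True, True, True, False),
      (False, True, False, False, True, False, True, True, False, False),
      (False, False, True, True, False, False, False, True, True, False),
      (False, False, True, True, False, True, False, False, True, False),
      (False, False, True, True, False, True, False, True, True, False),
      (False, False, True, True, False, False, True, False, True, False),
      (False, False, True, True, False, False, True, True, False, False),
      (False, False, True, True, False, False, True, True, True, False),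
      (False, False, True, False, True, True, False, False, True, False)}"
proof -
  \<comment> \<open>Each weight vector satisfies all equations but those of the listed atoms.\<close>
  have v1: "aab \<or> aac \<or> abc \<or> bbc" using rigid[of 1 1 1 2] by fastforce
  have v2: "aab \<or> acd \<or> bcd \<or> ccd" using rigid[of 1 1 2 2] by fastforce
  have v3: "aab \<or> aad \<or> abd \<or> bbd \<or> ccd" using rigid[of 1 1 2 3] by fastforce
  have v4: "aac \<or> aad \<or> abd \<or> bbc \<or> bcd \<or> ccd" using rigid[of 1 2 3 4] by fastforce
  have v5: "aad \<or> abc \<or> bbc \<or> bbd \<or> bcd \<or> ccd" using rigid[of 1 2 2 3] by fastforce
  have v6: "aac \<or> abc \<or> abd \<or> bbc \<or> bbd \<or> bcd" using rigid[of 1 2 1 2] by fastforce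
  have v7: "aab \<or> aac \<or> abd \<or> bbc \<or> bbd \<or> bcd" using rigid[of 1 0 1 2] by fastforce
  have v8: "aab \<or> aac \<or> aad \<or> abd \<or> bbc \<or> acd" using rigid[of 0 1 1 2] by fastforce
  have v9: "aab \<or> aac \<or> aad \<or> abc \<or> bbd \<or> acd \<or> ccd" using rigid[of 2 1 2 3] by fastforce
  have v10: "aab \<or> aac \<or> abd \<or> bbc \<or> bbd \<or> acd \<or> ccd" using rigid[of 2 1 3 4] by fastforce
  have v11: "aab \<or> aad \<or> abc \<or> abd \<or> bbc \<or> bcd \<or> ccd" using rigid[of 2 3 4 6] by fastforce
  have v12: "aac \<or> aad \<or> abc \<or> bbc \<or> bbd \<or> acd \<or> bcd" using rigid[of 2 4 3 6] by fastforce
  have v13: "aab \<or> aac \<or> abc \<or> abd \<or> bbd \<or> acd \<or> ccd" using rigid[of 3 2 4 6] by fastforce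
  \<comment> \<open>Of the 1024 assignments, \<open>excl\<close> leaves 4 * 3 * 3 * 2 * 2 * 2 = 288:
    four values for \<open>aa\<close>, three each for \<open>ab\<close> and \<open>bb\<close>, two
    each for \<open>ac\<close>, \<open>bc\<close> and \<open>cc\<close>. The other facts refute all
    but twelve of these.\<close>
  show ?thesis
    by (insert excl jac v1 v2 v3 v4 v5 v6 v7 v8 v9 v10 v11 v12 v13, unfold insert_iff empty_iff prod.inject;
      cases aab; (simp only: simp_thms)?;
      cases aac; (simp only: simp_thms)?;
      cases aad; (simp only: simp_thms)?;
      cases abc; (simp only: simp_thms)?;
      cases abd; (simp only: simp_thms)?;
      cases bbc; (simp only: simp_thms)?;
      cases bbd; (simp only: simp_thms)?;
      cases acd; (simp only: simp_thms)?;
      cases bcd; (simp only: simp_thms)?;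
      cases ccd; (simp only: simp_thms)?)
qed

text \<open>The assumptions \<open>order\<close> make every product later than both factors in the
  order \<open>a, b, c, d\<close>; they name the left factor only, and \<open>comm\<close> supplies
  the right one. Hence \<open>d\<close> annihilates everything and a product with \<open>c\<close>
  is zero or \<open>d\<close>.\<close>

lemma classification:
  fixes t :: "'i \<Rightarrow> 'i \<Rightarrow> 'i option"
  assumes dist: "distinct [a, b, c, d]" and UNIV: "(UNIV :: 'i set) = {a, b, c, d}"
    and comm: "\<And>i j. t i j = t j i"
    and jac: "\<And>i j l e f. t i j = Some e \<Longrightarrow> t e l = Some f \<Longrightarrow>
      (\<exists>g. t j l = Some g \<and> t g i = Some f) \<or> (\<exists>g. t l i = Some g \<and> t g j = Some f)"
    and rigid: "\<And>(w :: 'i \<Rightarrow> complex) i. (\<And>i j e. t i j = Some e \<Longrightarrow> w i + w j = w e) \<Longrightarrow> w i = 0"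
    and order: "\<And>i j. t i j \<noteq> Some a" "\<And>i j. t i j = Some b \<Longrightarrow> i = a"
      "\<And>i j. t i j = Some c \<Longrightarrow> i \<in> {a, b}" "\<And>i j. t i j = Some d \<Longrightarrow> i \<in> {a, b, c}"
  shows "\<exists>\<sigma> :: label \<Rightarrow> 'i. bij \<sigma> \<and> (\<exists>T \<in> tables. realizes t \<sigma> T)"
proof -
  have ne [simp]: "a \<noteq> b" "a \<noteq> c" "a \<noteq> d" "b \<noteq> c" "b \<noteq> d" "c \<noteq> d"
    "b \<noteq> a" "c \<noteq> a" "d \<noteq> a" "c \<noteq> b" "d \<noteq> b" "d \<noteq> c"
    using dist by auto
  have val: "t i j = None \<or> t i j = Some a \<or> t i j = Some b \<or> t i j = Some c \<or> t i j = Some d" for i j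
    using UNIV by (cases "t i j") auto
  have td: "t d j = None" for j using val[of d j] order[of d j] by auto
  have td': "t j d = None" for j using td[of j] comm[of j d] by simp
  have aa: "t a a = None \<or> t a a = Some b \<or> t a a = Some c \<or> t a a = Some d"
    using val[of a a] order[of a a] by auto
  have ab: "t a b = None \<or> t a b = Some c \<or> t a b = Some d"
    using val[of a b] order[of b a] comm[of a b] order(1)[of a b] by auto
  have bb: "t b b = None \<or> t b b = Some c \<or> t b b = Some d"
    using val[of b b] order[of b b] by auto
  have c_: "t j c = None \<or> t j c = Some d" for j
    using val[of j c] order[of c j] comm[of j c] by auto
  have c': "t c j = None \<or> t c j = Some d" for j
    using c_[of j] comm[of j c] by simp
  have flip: "t b a = t a b" "t c a = t a c" "t c b = t b c" by (rule comm)+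
  \<comment> \<open>\<open>F1\<close> to \<open>F5\<close> apply \<open>jac\<close> to the iterated
    products \<open>(aa)c\<close>, \<open>(ij)c\<close>, \<open>(aa)b\<close>, \<open>(aa)b\<close>
    and \<open>(bb)a\<close>. A term whose inner product is \<open>d\<close> is dead, so a
    compensating term must have inner product \<open>c\<close>, or cannot exist at all.\<close>
  have F1: "t b c = None" if "t a a = Some b"
    using c_[of b] c_[of a] c'[of a] jac[OF that, of c d] td by auto
  have F2: "t c c = None" if "t a a = Some c \<or> t a b = Some c \<or> t b b = Some c"
  proof -
    have "t c c = None" if "t i j = Some c" for i j
      using c_[of c] c'[of i] c_[of j] jac[OF that, of c d] td by auto
    then show ?thesis using that by blast
  qed
  have F3: "t a b = Some c \<and> t a c = t b b" if "t a a = Some b" "t b b \<noteq> None"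
    using that jac[OF that(1), of b] bb ab td flip c_[of a] by auto
  have F4: "t a b = Some c \<and> t a c = Some d" if "t a a = Some c" "t b c = Some d"
    using that jac[OF that(1), of b d] ab td flip by auto
  have F5: "t a b = Some c \<and> t b c = Some d" if "t b b = Some c" "t a c = Some d"
    using that jac[OF that(1), of a d] ab td flip by auto
  let ?b = "Some b" and ?c = "Some c" and ?d = "Some d"
  have R: "w1 = 0 \<and> w2 = 0 \<and> w3 = 0 \<and> w4 = 0"
    if R: "(t a a = Some b \<longrightarrow> w1 + w1 = w2) \<and> (t a a = Some c \<longrightarrow> w1 + w1 = w3) \<and>
      (t a a = Some d \<longrightarrow> w1 + w1 = w4) \<and> (t a b = Some c \<longrightarrow> w1 + w2 = w3) \<and>
      (t a b = Some d \<longrightarrow> w1 + w2 = w4) \<and> (t b b = Some c \<longrightarrow> w2 + w2 = w3) \<and>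
      (t b b = Some d \<longrightarrow> w2 + w2 = w4) \<and> (t a c = Some d \<longrightarrow> w1 + w3 = w4) \<and>
      (t b c = Some d \<longrightarrow> w2 + w3 = w4) \<and> (t c c = Some d \<longrightarrow> w3 + w3 = w4)"
    for w1 w2 w3 w4 :: complex
  proof -
    define w where "w x = (if x = a then w1 else if x = b then w2 else if x = c then w3 else w4)" for x
    have w: "w a = w1" "w b = w2" "w c = w3" "w d = w4" by (simp_all add: w_def)
    have "w a + w a = w e" if "t a a = Some e" for e using aa R that w by auto
    moreover have "w a + w b = w e" if "t a b = Some e" for e using ab R that w by auto
    moreover have "w b + w b = w e" if "t b b = Some e" for e using bb R that w by auto
    moreover have "w a + w c = w e" if "t a c = Some e" for e using c_[of a] R that w by auto
    moreover have "w b + w c = w e" if "t b c = Some e" for e using c_[of b] R that w by auto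
    moreover have "w c + w c = w e" if "t c c = Some e" for e using c_[of c] R that w by auto
    ultimately have S: "w i + w j = w e"
      if "t i j = Some e" "(i, j) \<in> {(a,a),(a,b),(b,b),(a,c),(b,c),(c,c)}" for i j e
      using that unfolding insert_iff empty_iff prod.inject by (elim disjE conjE FalseE; hypsubst; blast)
    have "w i + w j = w e" if "t i j = Some e" for i j e
    proof -
      have "i \<in> {a, b, c}" "j \<in> {a, b, c}" using UNIV that td td' by auto
      then consider "(i, j) \<in> {(a,a),(a,b),(b,b),(a,c),(b,c),(c,c)}" | "(j, i) \<in> {(a,a),(a,b),(b,b),(a,c),(b,c),(c,c)}"
        by blast
      then show ?thesis
      proof cases
        case 1
        then show ?thesis using S that by blast
      next
        case 2
        then show ?thesis using S[of j i e] that comm[of i j] by (simp add: add.commute)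
      qed
    qed
    from rigid[of w, OF this] show "w1 = 0 \<and> w2 = 0 \<and> w3 = 0 \<and> w4 = 0" using w by metis
  qed
  have none: "t a a = None \<longleftrightarrow> t a a \<noteq> ?b \<and> t a a \<noteq> ?c \<and> t a a \<noteq> ?d"
    "t a b = None \<longleftrightarrow> t a b \<noteq> ?c \<and> t a b \<noteq> ?d" "t b b = None \<longleftrightarrow> t b b \<noteq> ?c \<and> t b b \<noteq> ?d"
    "t j c = None \<longleftrightarrow> t j c \<noteq> ?d" for j
    using aa ab bb c_[of j] by (fastforce, fastforce, fastforce, fastforce)
  have cases: "(t a a = ?b, t a a = ?c, t a a = ?d, t a b = ?c, t a b = ?d, t b b = ?c, t b b = ?d,
      t a c = ?d, t b c = ?d, t c c = ?d) \<in> {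
      (False, False, False, True, False, False, True, True, True, False),
      (True, False, False, False, True, False, False, True, False, True),
      (False, True, False, True, False, False, True, True, False, False),
      (False, True, False, True, False, False, True, True, True, False),
      (False, True, False, False, True, False, True, True, False, False),
      (False, False, True, True, False, False, False, True, True, False),
      (False, False, True, True, False, True, False, False, True, False),
      (False, False, True, True, False, True, False, True, True, False),
      (False, False, True, True, False, False, True, False, True, False),
      (False, False, True, True, False, False, True, True, False, False),
      (False, False, True, True, False, False, True, True, True, False),
      (False, False, True, False, True, True, False, False, True, False)}"
  proof (rule weight_cases)
    show "t a a = ?b \<longrightarrow> t b c \<noteq> ?d" using F1 by auto
    show "t a a = ?c \<or> t a b = ?c \<or> t b b = ?c \<longrightarrow> t c c \<noteq> ?d" using F2 by auto
    show "t a a = ?b \<and> (t b b = ?c \<or> t b b = ?d) \<longrightarrow> t a b = ?c \<and> t a c = ?d \<and> t b b = ?d"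
      using F3 c_[of a] by auto
    show "t a a = ?c \<and> t b c = ?d \<longrightarrow> t a b = ?c \<and> t a c = ?d" using F4 by blast
    show "t b b = ?c \<and> t a c = ?d \<longrightarrow> t a b = ?c \<and> t b c = ?d" using F5 by blast
  qed ((rule R, assumption) | simp)+
  \<comment> \<open>The six tables, with \<open>x1, x2, x3, d\<close> in the roles of \<open>n, m, p, k\<close>.\<close>
  define P where "P x1 x2 x3 \<longleftrightarrow> (t x1 x1, t x1 x2, t x2 x2, t x1 x3, t x2 x3, t x3 x3) \<in>
    (let z1 = Some x3; z2 = Some d in {(z1,z1,z2,z2,z2,None), (z2,z1,None,z2,z2,None), (z2,z1,z2,z2,z2,None),
      (z1,z1,z2,z2,None,None), (z2,z1,z2,z2,None,None), (z1,z2,z2,z2,None,None)})" for x1 x2 x3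
  have concl: ?thesis if "P x1 x2 x3" "distinct [x1, x2, x3, d]" "{x1, x2, x3, d} = UNIV" for x1 x2 x3
  proof (rule exI[of _ "case_label x1 x2 x3 d"], rule conjI)
    let ?\<sigma> = "case_label x1 x2 x3 d"
    have "inj ?\<sigma>" unfolding inj_def using that(2) by (auto simp: all_label)
    moreover have "surj ?\<sigma>"
      unfolding surj_def ex_label using that(3) by auto
    ultimately show "bij ?\<sigma>" by (simp add: bij_def)
    have flip': "t x2 x1 = t x1 x2" "t x3 x1 = t x1 x3" "t x3 x2 = t x2 x3" by (rule comm)+
    have neq: "x1 \<noteq> x2" "x1 \<noteq> x3" "x1 \<noteq> d" "x2 \<noteq> x3" "x2 \<noteq> d" "x3 \<noteq> d"
      "x2 \<noteq> x1" "x3 \<noteq> x1" "d \<noteq> x1" "x3 \<noteq> x2" "d \<noteq> x2" "d \<noteq> x3"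
      using that(2) by auto
    show "\<exists>T\<in>tables. realizes t ?\<sigma> T"
      using that(1) unfolding P_def Let_def insert_iff empty_iff prod.inject tables_def bex_simps
      by (elim disjE conjE FalseE; simp add: realizes_def all_label neq flip' td td')
  qed
  \<comment> \<open>The order of the labels is only a linear extension, so a table may occur for
    several orders; the last of the six occurs three times among the twelve patterns. Exchanging
    \<open>a\<close> with \<open>b\<close>, or \<open>b\<close> with \<open>c\<close>, brings every
    pattern into standard form.\<close>
  have "P a b c \<or> P b a c \<or> P a c b"
    using cases unfolding P_def Let_def insert_iff empty_iff prod.inject
    by (elim disjE conjE FalseE; simp add: none flip)
  then show ?thesis
    using concl[of a b c] concl[of b a c] concl[of a c b] UNIV by auto
qed

section \<open>Sorting the labels and assembling the result\<close>

lemma (in sympathetic_sum) exists_unproduced: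
  assumes "T \<noteq> {}"
  obtains c where "c \<in> T" "\<And>i j. mult i j = Some c \<Longrightarrow> i \<notin> T"
proof -
  obtain c where c: "c \<in> T" "c \<notin> act UNIV T" using product_nilpotent[of T] assms by blast
  have "i \<notin> T" if "mult i j = Some c" for i j
    using c(2) that mult_commute[of i j] unfolding act_def by auto
  then show ?thesis using that c(1) by blast
qed

lemma (in sympathetic_sum) realizes_table:
  assumes card: "card (UNIV :: 'i set) = 4"
  shows "\<exists>\<sigma> :: label \<Rightarrow> 'i. bij \<sigma> \<and> (\<exists>T \<in> tables. realizes mult \<sigma> T)"
proof -
  \<comment> \<open>A topological sort: applied to the complement of the labels \<open>F\<close>
    already placed, \<open>exists_unproduced\<close> yields a next label all of whose factors lie in
    \<open>F\<close>.\<close>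
  have pick: "\<exists>c. c \<notin> F \<and> (\<forall>i j. mult i j = Some c \<longrightarrow> i \<in> F)" if "card F < 4" for F
  proof -
    have "F \<noteq> UNIV" using that card by auto
    then have "UNIV - F \<noteq> {}" by blast
    then show ?thesis by (rule exists_unproduced) blast
  qed
  obtain a where a: "\<And>i j. mult i j \<noteq> Some a" using pick[of "{}"] by auto
  obtain b where b: "b \<notin> {a}" "\<And>i j. mult i j = Some b \<Longrightarrow> i \<in> {a}" using pick[of "{a}"] by auto
  obtain c where c: "c \<notin> {a, b}" "\<And>i j. mult i j = Some c \<Longrightarrow> i \<in> {a, b}"
    using pick[of "{a, b}"] b(1) by auto
  have "card {a, b, c} = 3" using b(1) c(1) by auto
  then obtain d where d: "d \<notin> {a, b, c}" "\<And>i j. mult i j = Some d \<Longrightarrow> i \<in> {a, b, c}"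
    using pick[of "{a, b, c}"] by auto
  have dist: "distinct [a, b, c, d]" using b(1) c(1) d(1) by auto
  then have "card {a, b, c, d} = card (UNIV :: 'i set)" using card by simp
  then have UNIV: "(UNIV :: 'i set) = {a, b, c, d}"
    using card_subset_eq[of "UNIV :: 'i set" "{a, b, c, d}"] by simp
  show ?thesis
  proof (rule classification[OF dist UNIV])
    show "w i = 0" if "\<And>i j e. mult i j = Some e \<Longrightarrow> w i + w j = w e" for w :: "'i \<Rightarrow> complex" and i
      using that by (rule weights_zero)
    show "i = a" if "mult i j = Some b" for i j using b(2)[OF that] by simp
  qed (fact mult_commute mult_jacobi a c(2) d(2))+
qed

instance label :: finite
  by standard (simp add: UNIV_label)

theorem proposition3p17:
  fixes scale :: "complex \<Rightarrow> 'a::ab_group_add \<Rightarrow> 'a"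
    and bracket :: "'a \<Rightarrow> 'a \<Rightarrow> 'a"
    and L H :: "'a set"
    and V :: "label \<Rightarrow> 'a set"
  assumes "lie_algebra scale bracket"
    and "lie_algebra.levi_decomposition scale bracket L H"
    and "lie_algebra.simple_subalgebra scale bracket L"
    and "\<forall>i. lie_algebra.simple_submodule scale bracket L (V i)"
    and "lie_algebra.is_direct_sum scale UNIV V H"
    and "\<forall>i j. lie_algebra.bracket_span scale bracket (V i) (V j) \<noteq> {0} \<longrightarrow>
           (\<exists>!c. lie_algebra.bracket_span scale bracket (V i) (V j) = V c)"
    and "lie_algebra.sympathetic scale bracket"
  shows "\<exists>\<sigma> :: label \<Rightarrow> label. bij \<sigma> \<and>
    lie_algebra.is_direct_sum scale {p, k} (V \<circ> \<sigma>)
      (lie_algebra.bracket_span scale bracket H H) \<and>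
    lie_algebra.centre bracket H = (V \<circ> \<sigma>) k \<and>
    (\<exists>T \<in> {{(n, n, p), (n, m, p), (m, m, k), (n, p, k), (m, p, k)},
           {(n, n, k), (n, m, p), (n, p, k), (m, p, k)},
           {(n, n, k), (n, m, p), (m, m, k), (n, p, k), (m, p, k)},
           {(n, n, p), (n, m, p), (m, m, k), (n, p, k)},
           {(n, n, k), (n, m, p), (m, m, k), (n, p, k)},
           {(n, n, p), (n, m, k), (m, m, k), (n, p, k)}}.
       lie_algebra.has_table scale bracket (V \<circ> \<sigma>) T)"
proof -
  interpret sympathetic_sum scale bracket L H V
    using assms by (simp add: sympathetic_sum_def sympathetic_sum_axioms_def)
  have "card (UNIV :: label set) = 4" by (simp add: UNIV_label)
  from realizes_table[OF this] obtain \<sigma> :: "label \<Rightarrow> label" and T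
    where \<sigma>: "bij \<sigma>" and T: "T \<in> tables" and r: "realizes mult \<sigma> T" by blast
  have surj: "\<exists>j. i = \<sigma> j" for i using \<sigma> by (metis bij_pointE)
  have some: "mult (\<sigma> i) (\<sigma> j) = Some (\<sigma> c) \<longleftrightarrow> (i, j, c) \<in> T \<or> (j, i, c) \<in> T" for i j c
    using r unfolding realizes_def by blast
  have none: "mult (\<sigma> i) (\<sigma> j) = None" if "\<forall>c. (i, j, c) \<notin> T \<and> (j, i, c) \<notin> T" for i j
  proof (cases "mult (\<sigma> i) (\<sigma> j)")
    case (Some e)
    then show ?thesis using some[of i j] that surj[of e] by auto
  qed
  have products: "{c. \<exists>i j. mult i j = Some c} = \<sigma> ` {c. \<exists>i j. (i, j, c) \<in> T \<or> (j, i, c) \<in> T}"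
  proof (intro set_eqI iffI)
    fix c assume "c \<in> {c. \<exists>i j. mult i j = Some c}"
    then obtain i j where "mult i j = Some c" by blast
    then show "c \<in> \<sigma> ` {c. \<exists>i j. (i, j, c) \<in> T \<or> (j, i, c) \<in> T}"
      using surj[of i] surj[of j] surj[of c] some by blast
  qed (use some in blast)
  have "is_direct_sum {p, k} (V \<circ> \<sigma>) (bracket_span H H)"
  proof (rule derived_H_direct_sum)
    show "inj_on \<sigma> {p, k}" using \<sigma> bij_is_inj inj_on_subset by blast
    show "{c. \<exists>i j. mult i j = Some c} = \<sigma> ` {p, k}" using products tables_products[OF T] by simp
  qed simp
  moreover have "centre H = (V \<circ> \<sigma>) k"
    unfolding o_apply
  proof (rule centre_H_eq)
    show "mult i (\<sigma> k) = None" for i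
    proof -
      obtain j where j: "i = \<sigma> j" using surj by blast
      show ?thesis unfolding j by (rule none) (use tables_k[OF T] in simp)
    qed
    fix N
    assume N: "\<And>i j e. i \<in> N \<Longrightarrow> mult i j = Some e \<Longrightarrow> \<exists>i'\<in>N. i' \<noteq> i \<and> mult i' j = Some e"
    \<comment> \<open>The matching condition on \<open>N\<close> is pulled back along the
      relabelling, so that it can be decided on the explicit tables.\<close>
    have "\<sigma> -` N \<subseteq> {k}"
    proof (rule tables_centre[OF T])
      fix i j e assume "i \<in> \<sigma> -` N" "(i, j, e) \<in> T \<or> (j, i, e) \<in> T"
      then obtain i' where i': "i' \<in> N" "i' \<noteq> \<sigma> i" "mult i' (\<sigma> j) = Some (\<sigma> e)"
        using N[of "\<sigma> i" "\<sigma> j" "\<sigma> e"] some by auto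
      moreover obtain i'' where "i' = \<sigma> i''" using surj by blast
      ultimately show "\<exists>i'. i' \<in> \<sigma> -` N \<and> i' \<noteq> i \<and> ((i', j, e) \<in> T \<or> (j, i', e) \<in> T)"
        using some by auto
    qed
    show "N \<subseteq> {\<sigma> k}"
    proof
      fix i assume "i \<in> N"
      moreover obtain j where j: "i = \<sigma> j" using surj by blast
      ultimately have "j \<in> {k}" using \<open>\<sigma> -` N \<subseteq> {k}\<close> by blast
      then show "i \<in> {\<sigma> k}" by (simp add: j)
    qed
  qed
  moreover have "has_table (V \<circ> \<sigma>) T"
    unfolding has_table_def
  proof (intro conjI ballI allI impI)
    fix x assume "x \<in> T"
    moreover obtain i j c where x: "x = (i, j, c)" by (cases x)
    ultimately have "mult (\<sigma> i) (\<sigma> j) = Some (\<sigma> c)" using some by blast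
    then show "case x of (i, j, c) \<Rightarrow> bracket_span ((V \<circ> \<sigma>) i) ((V \<circ> \<sigma>) j) = (V \<circ> \<sigma>) c"
      by (simp add: x mult_Some)
  next
    fix i j assume "\<forall>c. (i, j, c) \<notin> T \<and> (j, i, c) \<notin> T"
    then show "bracket_span ((V \<circ> \<sigma>) i) ((V \<circ> \<sigma>) j) = {0}"
      unfolding o_apply mult_None[symmetric] by (rule none)
  qed
  ultimately show ?thesis
    using \<sigma> T[unfolded tables_def] by (intro exI[of _ \<sigma>] conjI bexI[of _ T])
qed

end
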